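(* Let $h$ and $p_0^*$ satisfy Assumptions (A1)–(A3) (given in the context) and let $\beta>0$. Consider the particle filter $$\frac{dX_t^i}{dt}=-\beta\nabla\phi_t(X_t^i),\qquad X_0^i\sim p_0^*,$$ where, with $p(\cdot,t)$ the density of $X_t^i$ and $\hat h_t=\int h(x)p(x,t)\,dx$, $\phi_t$ is the solution of $$-\nabla\cdot\big(p(x,t)\nabla\phi_t(x)\big)=(h(x)-\hat h_t)\,p(x,t),\qquad\int\phi_t(x)p(x,t)\,dx=0 .$$ Suppose the density admits a parametric form $p(x,t)=\varrho(x;\theta_t)$ with parameter vector $\theta_t\in\mathbb R^M$, and suppose that the Fisher information matrix $$G_{(\vartheta)}=\int\frac{\partial}{\partial\vartheta}\big(\log\varrho(x;\vartheta)\big)\Big[\frac{\partial}{\partial\vartheta}\big(\log\varrho(x;\vartheta)\big)\Big]^T\varrho(x;\vartheta)\,dx$$ is invertible for all $\vartheta\in\mathbb R^M$. Then $\theta_t$ is a solution of the ordinary differential equation $$\frac{d\theta_t}{dt}=-\beta\,G_{(\theta_t)}^{-1}\nabla e(\theta_t),$$ where $e(\vartheta):=\int h(x)\varrho(x;\vartheta)\,dx$, with gradient the $M\times1$ column vector $$\nabla e(\vartheta)=\int h(x)\frac{\partial}{\partial\vartheta}\big(\log\varrho(x;\vartheta)\big)\varrho(x;\vartheta)\,dx .$$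
   Context: $\varrho(\cdot;\vartheta)$, $\vartheta\in\mathbb R^M$, is a given family of probability densities on $\mathbb R^d$, and $\frac{\partial}{\partial\vartheta}\log\varrho(x;\vartheta)$ is the $M\times1$ column vector with entries $\frac{\partial}{\partial\vartheta_k}\log\varrho(x;\vartheta)$; the family and $t\mapsto\theta_t$ are tacitly smooth enough for these expressions and differentiation under the integral to make sense. $\phi_t$ is the weak solution: $\phi_t\in H^1(\mathbb R^d;\rho)$, $\int\phi_t\rho\,dx=0$, $\int\nabla\phi_t\cdot\nabla\psi\,\rho\,dx=\int(h-\hat h_t)\psi\rho\,dx$ for all $\psi\in H^1(\mathbb R^d;\rho)$, with $\rho=p(\cdot,t)$, where $H^1(\mathbb R^d;\rho)$ is the space of functions in $L^2(\mathbb R^d;\rho)$ with weak derivatives in $L^2(\mathbb R^d;\rho)$. Assumptions. (A1) $p_0^*$ is a probability density with finite second moment, of the form $e^{-V_0}$ with $V_0\in C^2(\mathbb R^d)$, $D^2V_0\in L^\infty$, $\liminf_{|x|\to\infty}\nabla V_0(x)\cdot\frac{x}{|x|}=\infty$. (A2) $h:\mathbb R^d\to\mathbb R$, $h\in C^2\cap L^2(\mathbb R^d;p_0^* )$, $D^2h\in L^\infty$, $\liminf_{|x|\to\infty}\nabla h(x)\cdot\frac{x}{|x|}>-\infty$. (A3) $h$ has a unique minimizer $\bar x$ with value $\bar h=h(\bar x)$, and there are a compact $D\subset\mathbb R^d$ and $r>0$ with $h(x)>\bar h+r$ for $x\notin D$. *)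

theory Defs
  imports "HOL-Probability.Probability"
begin

definition grad :: "('a::euclidean_space \<Rightarrow> real) \<Rightarrow> 'a \<Rightarrow> 'a" where
  "grad f x = (\<Sum>b\<in>Basis. frechet_derivative f (at x) b *\<^sub>R b)"

primrec Ck :: "nat \<Rightarrow> ('a::euclidean_space \<Rightarrow> real) \<Rightarrow> bool" where
  "Ck 0 f \<longleftrightarrow> continuous_on UNIV f"
| "Ck (Suc k) f \<longleftrightarrow> (\<forall>x. f differentiable (at x)) \<and>
     (\<forall>b\<in>Basis. Ck k (\<lambda>x. frechet_derivative f (at x) b))"

text \<open>Only used for functions of class \<open>C\<^sup>2\<close>, whose Hessian is continuous, so that
  the essential supremum and the supremum of its entries agree.\<close>

definition bounded_hessian :: "('a::euclidean_space \<Rightarrow> real) \<Rightarrow> bool" where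
  "bounded_hessian f \<longleftrightarrow> (\<exists>C. \<forall>x. \<forall>b\<in>Basis. \<forall>c\<in>Basis.
     \<bar>frechet_derivative (\<lambda>y. frechet_derivative f (at y) b) (at x) c\<bar> \<le> C)"

definition liminf_radial_derivative :: "('a::euclidean_space \<Rightarrow> real) \<Rightarrow> ereal" where
  "liminf_radial_derivative f =
     Liminf at_infinity (\<lambda>x. ereal (grad f x \<bullet> (x /\<^sub>R norm x)))"

definition prob_density :: "('a::euclidean_space \<Rightarrow> real) \<Rightarrow> bool" where
  "prob_density \<rho> \<longleftrightarrow> (\<forall>x. 0 \<le> \<rho> x) \<and> integrable lborel \<rho> \<and> (\<integral>x. \<rho> x \<partial>lborel) = 1"

definition assumption_A1 :: "('a::euclidean_space \<Rightarrow> real) \<Rightarrow> bool" where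
  "assumption_A1 p0 \<longleftrightarrow> prob_density p0 \<and> integrable lborel (\<lambda>x. (norm x)\<^sup>2 * p0 x) \<and>
     (\<exists>V. (\<forall>x. p0 x = exp (- V x)) \<and> Ck 2 V \<and> bounded_hessian V \<and>
          liminf_radial_derivative V = \<infinity>)"

definition assumption_A2 :: "('a::euclidean_space \<Rightarrow> real) \<Rightarrow> ('a \<Rightarrow> real) \<Rightarrow> bool" where
  "assumption_A2 p0 h \<longleftrightarrow> Ck 2 h \<and> integrable lborel (\<lambda>x. (h x)\<^sup>2 * p0 x) \<and>
     bounded_hessian h \<and> liminf_radial_derivative h > - \<infinity>"

definition assumption_A3 :: "('a::euclidean_space \<Rightarrow> real) \<Rightarrow> bool" where
  "assumption_A3 h \<longleftrightarrow> (\<exists>xbar. (\<forall>y. is_arg_min h (\<lambda>_. True) y \<longleftrightarrow> y = xbar) \<and>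
     (\<exists>D r. compact D \<and> r > 0 \<and> (\<forall>x. x \<notin> D \<longrightarrow> h x > h xbar + r)))"

definition test_function :: "('a::euclidean_space \<Rightarrow> real) \<Rightarrow> bool" where
  "test_function \<psi> \<longleftrightarrow> (\<forall>k. Ck k \<psi>) \<and> compact (closure {x. \<psi> x \<noteq> 0})"

definition weak_gradient :: "('a::euclidean_space \<Rightarrow> real) \<Rightarrow> ('a \<Rightarrow> 'a) \<Rightarrow> bool" where
  "weak_gradient u g \<longleftrightarrow>
     (\<forall>K. compact K \<longrightarrow> set_integrable lborel K u) \<and>
     (\<forall>K. compact K \<longrightarrow> set_integrable lborel K g) \<and>
     (\<forall>\<psi>. test_function \<psi> \<longrightarrow> (\<forall>b\<in>Basis.
        (\<integral>x. u x * frechet_derivative \<psi> (at x) b \<partial>lborel) = - (\<integral>x. (g x \<bullet> b) * \<psi> x \<partial>lborel)))"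

text \<open>\<open>H1 \<rho> u g\<close>: \<open>u\<close> belongs to \<open>H\<^sup>1(\<rho>)\<close> and \<open>g\<close> is a version of its weak gradient.\<close>

definition H1 :: "('a::euclidean_space \<Rightarrow> real) \<Rightarrow> ('a \<Rightarrow> real) \<Rightarrow> ('a \<Rightarrow> 'a) \<Rightarrow> bool" where
  "H1 \<rho> u g \<longleftrightarrow> weak_gradient u g \<and>
     integrable lborel (\<lambda>x. (u x)\<^sup>2 * \<rho> x) \<and> integrable lborel (\<lambda>x. (norm (g x))\<^sup>2 * \<rho> x)"

definition mean :: "('a::euclidean_space \<Rightarrow> real) \<Rightarrow> ('a \<Rightarrow> real) \<Rightarrow> real" where
  "mean h \<rho> = (\<integral>x. h x * \<rho> x \<partial>lborel)"

text \<open>The weak form of \<open>- div (\<rho> \<nabla>\<phi>) = (h - mean h \<rho>) \<rho>\<close>, where \<open>g\<close> is a version of \<open>\<nabla>\<phi>\<close>.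
  Integrability of the right-hand side is required explicitly because the Bochner integral of a
  non-integrable function is 0; the left-hand side is always integrable by Cauchy-Schwarz.\<close>

definition weak_poisson_solution ::
  "('a::euclidean_space \<Rightarrow> real) \<Rightarrow> ('a \<Rightarrow> real) \<Rightarrow> ('a \<Rightarrow> real) \<Rightarrow> ('a \<Rightarrow> 'a) \<Rightarrow> bool" where
  "weak_poisson_solution h \<rho> \<phi> g \<longleftrightarrow> H1 \<rho> \<phi> g \<and> (\<integral>x. \<phi> x * \<rho> x \<partial>lborel) = 0 \<and>
     (\<forall>\<psi> g'. H1 \<rho> \<psi> g' \<longrightarrow>
        integrable lborel (\<lambda>x. (h x - mean h \<rho>) * \<psi> x * \<rho> x) \<and>
        (\<integral>x. (g x \<bullet> g' x) * \<rho> x \<partial>lborel) = (\<integral>x. (h x - mean h \<rho>) * \<psi> x * \<rho> x \<partial>lborel))"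

definition score :: "('a \<Rightarrow> real^'m \<Rightarrow> real) \<Rightarrow> 'a \<Rightarrow> real^'m \<Rightarrow> real^'m" where
  "score \<rho> x \<theta> = grad (\<lambda>\<eta>. ln (\<rho> x \<eta>)) \<theta>"

definition fisher_matrix ::
  "('a::euclidean_space \<Rightarrow> real^'m \<Rightarrow> real) \<Rightarrow> real^'m \<Rightarrow> real^'m^'m" where
  "fisher_matrix \<rho> \<theta> = (\<chi> i j. \<integral>x. score \<rho> x \<theta> $ i * score \<rho> x \<theta> $ j * \<rho> x \<theta> \<partial>lborel)"

definition expected_cost ::
  "('a::euclidean_space \<Rightarrow> real) \<Rightarrow> ('a \<Rightarrow> real^'m \<Rightarrow> real) \<Rightarrow> real^'m \<Rightarrow> real" where
  "expected_cost h \<rho> \<theta> = (\<integral>x. h x * \<rho> x \<theta> \<partial>lborel)"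

definition cost_gradient ::
  "('a::euclidean_space \<Rightarrow> real) \<Rightarrow> ('a \<Rightarrow> real^'m \<Rightarrow> real) \<Rightarrow> real^'m \<Rightarrow> real^'m" where
  "cost_gradient h \<rho> \<theta> = (\<chi> k. \<integral>x. h x * score \<rho> x \<theta> $ k * \<rho> x \<theta> \<partial>lborel)"

text \<open>Regularity of a parametric family of densities: positivity and \<open>C\<^sup>1\<close> dependence on the
  parameter, so that the score exists; well-definedness of the expected cost and of the Fisher
  information; and a local domination condition justifying differentiation under the integral
  in \<open>\<integral> \<rho> x \<theta> dx\<close> and \<open>\<integral> h x * \<rho> x \<theta> dx\<close> (note that \<open>\<nabla>\<^sub>\<theta> \<rho> = score * \<rho>\<close>).\<close>

definition regular_family ::
  "('a::euclidean_space \<Rightarrow> real) \<Rightarrow> ('a \<Rightarrow> real^'m \<Rightarrow> real) \<Rightarrow> bool" where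
  "regular_family h \<rho> \<longleftrightarrow>
     (\<forall>x \<theta>. 0 < \<rho> x \<theta>) \<and>
     (\<forall>\<theta>. prob_density (\<lambda>x. \<rho> x \<theta>)) \<and>
     continuous_on UNIV (\<lambda>(x, \<theta>). \<rho> x \<theta>) \<and>
     (\<forall>x \<theta>. (\<lambda>\<eta>. ln (\<rho> x \<eta>)) differentiable (at \<theta>)) \<and>
     (\<forall>x. continuous_on UNIV (score \<rho> x)) \<and>
     (\<forall>\<theta>. integrable lborel (\<lambda>x. h x * \<rho> x \<theta>)) \<and>
     (\<forall>\<theta> i j. integrable lborel (\<lambda>x. score \<rho> x \<theta> $ i * score \<rho> x \<theta> $ j * \<rho> x \<theta>)) \<and>
     (\<forall>\<theta>0. \<exists>\<epsilon>>0. \<exists>w. integrable lborel w \<and>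
        (\<forall>\<theta>\<in>ball \<theta>0 \<epsilon>. \<forall>x. (1 + \<bar>h x\<bar>) * norm (score \<rho> x \<theta>) * \<rho> x \<theta> \<le> w x))"

end

theory Submission
  imports Defs
begin

text \<open>
  Let \<open>\<psi>\<close> be a test function and \<open>m\<close> the mean of \<open>h\<close> at time \<open>t\<close>. Differentiating the expectation of
  \<open>\<psi> (X t)\<close> along the dynamics and inserting \<open>\<psi>\<close> into the weak Poisson equation gives, formally,
  \<open>- \<beta> * \<integral> (h - m) * \<psi> * p\<close>. The same expectation is \<open>\<integral> \<psi> * \<rho>\<close> at the parameter \<open>\<theta> t\<close>, and since the
  parameter gradient of \<open>\<rho>\<close> is \<open>score * \<rho>\<close>, its derivative is \<open>\<integral> \<psi> * (score \<bullet> \<theta>' t) * \<rho>\<close>. As \<open>\<psi>\<close> is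
  arbitrary, \<open>score \<bullet> \<theta>' t = - \<beta> * (h - m)\<close> almost everywhere (\<open>score_velocity_eq_centred_cost\<close>).
  Integrating this identity against the components of \<open>score * \<rho>\<close> produces the Fisher matrix on the left and
  \<open>- \<beta>\<close> times the gradient of the expected cost on the right, because the score has mean zero
  (\<open>natural_gradient_identity\<close>).

  The formal step exchanges the time derivative of \<open>\<psi> (X t)\<close> with the expectation. The exchange is
  justified on time intervals where the energy \<open>\<integral> (norm (\<nabla>\<phi>))\<^sup>2 * p\<close> is bounded
  (\<open>expectation_increment_has_integral\<close>), but the hypotheses make the energy finite only for each single time,
  with no uniformity. Two observations close the gap (\<open>weak_continuity_equation\<close>).

  First, both sides of the identity to be proved are continuous in time, so it suffices to have it on a
  dense set of times, and for this it suffices that every time interval contains a subinterval on which the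
  energy is bounded.

  Second, by Dirichlet's principle (\<open>dual_energy_le\<close>, \<open>cutoff_energy_tendsto\<close>) the energy is the supremum
  of \<open>2 * \<integral> (h - m) * u * p - \<integral> (norm (\<nabla>u))\<^sup>2 * p\<close> over competitors \<open>u\<close> that may be taken to be smooth
  cutoffs of the solutions \<open>\<phi> s\<close> at arbitrary times \<open>s\<close>. Such a competitor has compact support, and on
  compact sets all members of the family \<open>\<rho>\<close> are comparable, so it is admissible at every time and its
  functional is continuous in time. The energy is therefore a pointwise finite supremum of continuous functions of
  time,
  and Baire's theorem bounds it on a subinterval of every interval (\<open>energy_bounded_on_subinterval\<close>).
\<close>

section \<open>Gradients and functions of class \<open>C\<^sup>k\<close>\<close>

lemma inner_grad:
  fixes f :: "'a::euclidean_space \<Rightarrow> real"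
  assumes "f differentiable (at x)"
  shows "v \<bullet> grad f x = frechet_derivative f (at x) v"
proof -
  interpret linear "frechet_derivative f (at x)"
    using assms linear_frechet_derivative by blast
  have "frechet_derivative f (at x) v = frechet_derivative f (at x) (\<Sum>b\<in>Basis. (v \<bullet> b) *\<^sub>R b)"
    by (simp add: euclidean_representation)
  also have "\<dots> = (\<Sum>b\<in>Basis. (v \<bullet> b) * frechet_derivative f (at x) b)"
    by (simp add: sum scale)
  finally show ?thesis
    by (simp add: grad_def inner_sum_right mult.commute)
qed

lemma GDERIV_grad:
  fixes f :: "'a::euclidean_space \<Rightarrow> real"
  assumes "f differentiable (at x)"
  shows "GDERIV f x :> grad f x"
proof -
  have "frechet_derivative f (at x) = (\<lambda>v. v \<bullet> grad f x)"
    using inner_grad[OF assms] by auto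
  then show ?thesis
    using assms unfolding gderiv_def frechet_derivative_works by simp
qed

lemma Ck_differentiable: "Ck (Suc k) f \<Longrightarrow> f differentiable (at x)"
  by simp

lemma Ck_continuous: "Ck k f \<Longrightarrow> continuous_on UNIV f"
  by (cases k) (auto intro!: continuous_at_imp_continuous_on differentiable_imp_continuous_within)

lemma Ck_SucD: "Ck (Suc k) f \<Longrightarrow> Ck k f"
proof (induction k arbitrary: f)
  case 0
  then show ?case using Ck_continuous Ck.simps(1) by blast
next
  case (Suc k)
  then show ?case by (metis Ck.simps(2))
qed

lemma Ck_SucI:
  assumes "\<And>x. (f has_derivative D x) (at x)" and "\<And>b. b \<in> Basis \<Longrightarrow> Ck k (\<lambda>x. D x b)"
  shows "Ck (Suc k) f"
proof -
  have "frechet_derivative f (at x) = D x" for x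
    using assms(1) frechet_derivative_at by metis
  then show ?thesis
    using assms by (auto simp: differentiable_def)
qed

lemma Ck_const [simp]: "Ck k (\<lambda>x. c)"
proof (induction k arbitrary: c)
  case (Suc k)
  show ?case by (rule Ck_SucI[where D="\<lambda>_ _. 0"]) (auto simp: Suc)
qed auto

lemma Ck_add:
  assumes "Ck k f" "Ck k g" shows "Ck k (\<lambda>x. f x + g x)"
  using assms
proof (induction k arbitrary: f g)
  case (Suc k)
  then show ?case
    by (intro Ck_SucI[where D="\<lambda>x v. frechet_derivative f (at x) v + frechet_derivative g (at x) v"]
         has_derivative_add)
       (auto simp: frechet_derivative_works)
qed (auto intro: continuous_intros)

lemma Ck_mult:
  assumes "Ck k f" "Ck k g" shows "Ck k (\<lambda>x. f x * g x)"
  using assms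
proof (induction k arbitrary: f g)
  case (Suc k)
  have fg: "Ck k f" "Ck k g" using Suc.prems Ck_SucD by blast+
  show ?case
  proof (rule Ck_SucI)
    show "((\<lambda>x. f x * g x) has_derivative
        (\<lambda>v. f x * frechet_derivative g (at x) v + frechet_derivative f (at x) v * g x)) (at x)" for x
      using Suc.prems by (intro has_derivative_mult) (auto simp: frechet_derivative_works)
    show "Ck k (\<lambda>x. f x * frechet_derivative g (at x) b + frechet_derivative f (at x) b * g x)"
      if "b \<in> Basis" for b
      using Suc fg that by (intro Ck_add Suc.IH) auto
  qed
qed (auto intro: continuous_intros)

lemma Ck_diff:
  assumes "Ck k f" "Ck k g" shows "Ck k (\<lambda>x. f x - g x)"
  using Ck_add[OF assms(1) Ck_mult[OF Ck_const[of k "-1"] assms(2)]] by simp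

lemma Ck_inner [simp]: "Ck k (\<lambda>x. x \<bullet> b)"
proof (cases k)
  case (Suc n)
  show ?thesis unfolding Suc
    by (rule Ck_SucI[where D="\<lambda>x v. v \<bullet> b"]) (auto intro!: derivative_eq_intros)
qed (auto intro: continuous_intros)

lemma Ck_sum:
  assumes "finite I" "\<And>i. i \<in> I \<Longrightarrow> Ck k (f i)" shows "Ck k (\<lambda>x. \<Sum>i\<in>I. f i x)"
  using assms by (induction I rule: finite_induct) (auto intro: Ck_add)

lemma Ck_prod:
  assumes "finite I" "\<And>i. i \<in> I \<Longrightarrow> Ck k (f i)" shows "Ck k (\<lambda>x. \<Prod>i\<in>I. f i x)"
  using assms by (induction I rule: finite_induct) (auto intro: Ck_mult)

lemma continuous_on_grad:
  assumes "Ck (Suc k) f" shows "continuous_on UNIV (grad f)"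
  unfolding grad_def [abs_def] using assms Ck_continuous
  by (auto intro!: continuous_intros)

section \<open>Smooth functions with compact support\<close>

text \<open>The functions \<open>exp (- 1 / x) / x ^ n\<close> on the positive half-line, extended by \<open>0\<close>. Differentiating one
  of them gives a linear combination of two others, so the whole family is smooth by a simultaneous
  induction; this is why the power of \<open>1 / x\<close> is kept as a parameter.\<close>

definition flat_exp :: "nat \<Rightarrow> real \<Rightarrow> real" where
  "flat_exp n x = (if x \<le> 0 then 0 else inverse x ^ n * exp (- inverse x))"

lemma flat_exp_tendsto_0: "(flat_exp n \<longlongrightarrow> 0) (at 0)"
proof -
  have "((\<lambda>x. x ^ n / exp x) \<longlongrightarrow> (0::real)) at_top"
    by (rule tendsto_power_div_exp_0)
  then have "((\<lambda>x. inverse x ^ n / exp (inverse x)) \<longlongrightarrow> (0::real)) (at_right 0)"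
    by (rule filterlim_compose) (rule filterlim_inverse_at_top_right)
  then have "(flat_exp n \<longlongrightarrow> 0) (at_right 0)"
    by (rule Lim_transform_eventually)
       (auto simp: eventually_at_right_less flat_exp_def exp_minus divide_simps
             intro!: eventually_at_rightI[of 0 1])
  moreover have "(flat_exp n \<longlongrightarrow> 0) (at_left 0)"
    by (rule Lim_transform_eventually[OF tendsto_const])
       (auto simp: flat_exp_def intro!: eventually_at_leftI[of "-1" 0])
  ultimately show ?thesis by (simp add: filterlim_split_at)
qed

text \<open>At the origin the difference quotient of \<open>flat_exp n\<close> is \<open>flat_exp (n + 1)\<close>, which tends to \<open>0\<close>.\<close>

lemma flat_exp_has_derivative:
  "(flat_exp n has_real_derivative (flat_exp (n + 2) x - n * flat_exp (n + 1) x)) (at x)"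
proof (cases x "0::real" rule: linorder_cases)
  case less
  have "((\<lambda>_. 0) has_real_derivative 0) (at x)" by simp
  then have "(flat_exp n has_real_derivative 0) (at x)"
    by (rule DERIV_cong_ev[THEN iffD1, rotated -1])
       (use less in \<open>auto simp: flat_exp_def intro!: eventually_nhds_in_open[of "{..<0}", THEN eventually_mono]\<close>)
  then show ?thesis using less by (simp add: flat_exp_def)
next
  case equal
  have "((\<lambda>h. (flat_exp n (0 + h) - flat_exp n 0) / h) \<longlongrightarrow> 0) (at 0)"
    by (rule Lim_transform_eventually[OF flat_exp_tendsto_0[of "Suc n"]])
       (auto simp: flat_exp_def divide_simps intro!: always_eventually)
  then show ?thesis using equal by (simp add: DERIV_def flat_exp_def)
next
  case greater
  have "((\<lambda>x. inverse x ^ n * exp (- inverse x)) has_real_derivative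
      (inverse x ^ (n + 2) * exp (- inverse x) - n * (inverse x ^ (n + 1) * exp (- inverse x)))) (at x)"
    using greater
    by (auto intro!: derivative_eq_intros simp: power2_eq_square)
       (cases n; simp add: field_simps)
  then have "(flat_exp n has_real_derivative
      (inverse x ^ (n + 2) * exp (- inverse x) - n * (inverse x ^ (n + 1) * exp (- inverse x)))) (at x)"
    by (rule DERIV_cong_ev[THEN iffD1, rotated -1])
       (use greater in \<open>auto simp: flat_exp_def intro!: eventually_nhds_in_open[of "{0<..}", THEN eventually_mono]\<close>)
  then show ?thesis using greater by (simp add: flat_exp_def)
qed

lemma Ck_flat_exp_compose:
  assumes "\<And>k. Ck k q" shows "Ck k (\<lambda>x. flat_exp n (q x))"
proof (induction k arbitrary: n)
  case 0
  have "continuous_on UNIV (flat_exp n)"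
    by (meson DERIV_isCont flat_exp_has_derivative continuous_at_imp_continuous_on)
  then show ?case
    using Ck_continuous[OF assms] by (auto intro: continuous_on_compose2)
next
  case (Suc k)
  show ?case
  proof (rule Ck_SucI)
    show "((\<lambda>x. flat_exp n (q x)) has_derivative
       (\<lambda>v. (flat_exp (n + 2) (q x) - n * flat_exp (n + 1) (q x)) * frechet_derivative q (at x) v)) (at x)" for x
    proof -
      have "(q has_derivative frechet_derivative q (at x)) (at x)"
        using assms Ck_differentiable frechet_derivative_works by blast
      from has_derivative_compose[OF this flat_exp_has_derivative[unfolded has_field_derivative_def]]
      show ?thesis by simp
    qed
    show "Ck k (\<lambda>x. (flat_exp (n + 2) (q x) - n * flat_exp (n + 1) (q x)) * frechet_derivative q (at x) b)"
      if "b \<in> Basis" for b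
      using assms[of "Suc k"] that by (intro Ck_mult Ck_diff Ck_const Suc.IH) auto
  qed
qed

lemma flat_exp_measurable [measurable]: "flat_exp n \<in> borel_measurable borel"
  unfolding flat_exp_def[abs_def] by measurable

lemma flat_exp_bounds: "0 \<le> flat_exp n x" "flat_exp 0 x \<le> 1"
  by (auto simp: flat_exp_def)

lemma flat_exp_2_le: "flat_exp 2 x \<le> 2"
proof (cases "x \<le> 0")
  case False
  define z where "z = inverse x"
  have "z > 0" using False by (simp add: z_def)
  have "z\<^sup>2 / 2 \<le> exp z"
    using exp_lower_Taylor_quadratic[of z] \<open>z > 0\<close> by linarith
  then have "z\<^sup>2 * exp (- z) \<le> 2"
    by (simp add: exp_minus field_simps)
  then show ?thesis using False by (simp add: flat_exp_def z_def)
qed (simp add: flat_exp_def)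

lemma test_function_bounded_support:
  assumes "\<And>k. Ck k \<psi>" and "\<And>x. \<psi> x \<noteq> 0 \<Longrightarrow> x \<in> K" and "compact K"
  shows "test_function \<psi>"
proof -
  have "{x. \<psi> x \<noteq> 0} \<subseteq> K" using assms(2) by auto
  then have "bounded {x. \<psi> x \<noteq> 0}"
    using assms(3) bounded_subset compact_imp_bounded by blast
  then show ?thesis using assms(1) by (simp add: test_function_def)
qed

lemma test_function_mult:
  assumes "test_function \<psi>" "test_function \<kappa>"
  shows "test_function (\<lambda>x. \<psi> x * \<kappa> x)"
proof (rule test_function_bounded_support)
  show "Ck k (\<lambda>x. \<psi> x * \<kappa> x)" for k
    using assms by (auto simp: test_function_def intro!: Ck_mult)
  show "compact (closure {x. \<psi> x \<noteq> 0})"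
    using assms by (simp add: test_function_def)
  show "x \<in> closure {x. \<psi> x \<noteq> 0}" if "\<psi> x * \<kappa> x \<noteq> 0" for x
    using that by (intro closure_subset[THEN subsetD]) simp
qed

text \<open>The factor \<open>exp 1\<close> normalises the value at the origin to \<open>1\<close>. The function is not constant near the
  origin, but it tends to \<open>1\<close> pointwise as \<open>r\<close> grows, while its gradient is of order \<open>1 / r\<close>.\<close>

definition cutoff :: "real \<Rightarrow> 'a::euclidean_space \<Rightarrow> real" where
  "cutoff r x = exp 1 * flat_exp 0 (1 - (x \<bullet> x) / r\<^sup>2)"

lemma test_function_cutoff:
  assumes "0 < r"
  shows "test_function (cutoff r :: 'a::euclidean_space \<Rightarrow> real)"
proof (rule test_function_bounded_support)
  have "Ck k (\<lambda>x::'a. (x \<bullet> x) * (1 / r\<^sup>2))" for k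
    by (subst euclidean_inner) (intro Ck_mult Ck_sum Ck_const Ck_inner finite_Basis)
  then have "Ck k (\<lambda>x::'a. 1 - (x \<bullet> x) / r\<^sup>2)" for k
    using Ck_diff[OF Ck_const[of k 1], of "\<lambda>x::'a. (x \<bullet> x) * (1 / r\<^sup>2)"] by simp
  then show "Ck k (cutoff r :: 'a \<Rightarrow> real)" for k
    unfolding cutoff_def[abs_def]
    by (intro Ck_mult Ck_const Ck_flat_exp_compose)
  show "compact (cball (0::'a) r)" by simp
  show "x \<in> cball 0 r" if "cutoff r x \<noteq> 0" for x :: 'a
  proof -
    have "norm x < r"
      using that assms
      by (auto simp: cutoff_def flat_exp_def field_simps dot_square_norm split: if_splits)
    then show ?thesis by simp
  qed
qed

lemma cutoff_nonneg: "0 \<le> cutoff r x"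
  by (simp add: cutoff_def flat_exp_bounds)

lemma cutoff_le_1: "cutoff r x \<le> 1"
proof (cases "1 - (x \<bullet> x) / r\<^sup>2 \<le> 0")
  case False
  define y where "y = 1 - (x \<bullet> x) / r\<^sup>2"
  have "0 < y" "y \<le> 1" using False by (auto simp: y_def)
  then have "1 \<le> inverse y" by (simp add: one_le_inverse_iff)
  then have "exp (1 + - inverse y) \<le> 1" by simp
  then show ?thesis using \<open>0 < y\<close>
    unfolding cutoff_def y_def[symmetric] flat_exp_def exp_add by simp
qed (simp add: cutoff_def flat_exp_def)

lemma grad_cutoff:
  "grad (cutoff r) x = (exp 1 * flat_exp 2 (1 - (x \<bullet> x) / r\<^sup>2) * (- 2 / r\<^sup>2)) *\<^sub>R x"
proof -
  define c where "c = 1 / r\<^sup>2"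
  have "((\<lambda>x. 1 - (x \<bullet> x) * c) has_derivative (\<lambda>v. - (2 * (x \<bullet> v)) * c)) (at x)"
    by (auto intro!: derivative_eq_intros simp: inner_commute)
  from has_derivative_compose[OF this flat_exp_has_derivative[of 0, unfolded has_field_derivative_def]]
  have "(cutoff r has_derivative
    (\<lambda>v. exp 1 * (flat_exp 2 (1 - (x \<bullet> x) * c) * (- (2 * (x \<bullet> v)) * c)))) (at x)"
    unfolding cutoff_def[abs_def] c_def by (intro has_derivative_mult_right) (simp add: numeral_2_eq_2)
  then have "frechet_derivative (cutoff r) (at x) =
    (\<lambda>v. exp 1 * (flat_exp 2 (1 - (x \<bullet> x) * c) * (- (2 * (x \<bullet> v)) * c)))"
    using frechet_derivative_at by metis
  then have "grad (cutoff r) x =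
    (\<Sum>b\<in>Basis. (exp 1 * flat_exp 2 (1 - (x \<bullet> x) * c) * (- 2 * c)) *\<^sub>R ((x \<bullet> b) *\<^sub>R b))"
    unfolding grad_def by (intro sum.cong) (auto simp: algebra_simps)
  also have "\<dots> = (exp 1 * flat_exp 2 (1 - (x \<bullet> x) * c) * (- 2 * c)) *\<^sub>R x"
    by (simp only: scaleR_sum_right[symmetric] euclidean_representation)
  finally show ?thesis by (simp add: c_def)
qed

text \<open>The gradient is supported in the ball of radius \<open>r\<close> and its length there is at most a constant
  times \<open>r / r\<^sup>2\<close>.\<close>

lemma norm_grad_cutoff_le:
  assumes "0 < r" shows "norm (grad (cutoff r) x) \<le> 4 * exp 1 / r"
proof (cases "norm x \<le> r")
  case True
  have "norm (grad (cutoff r) x) =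
      exp 1 * flat_exp 2 (1 - (x \<bullet> x) / r\<^sup>2) * (2 / r\<^sup>2) * norm x"
    unfolding grad_cutoff by (simp add: flat_exp_bounds abs_mult)
  also have "\<dots> \<le> exp 1 * 2 * (2 / r\<^sup>2) * r"
    using True by (intro mult_mono flat_exp_2_le) (auto simp: flat_exp_bounds)
  also have "\<dots> = 4 * exp 1 / r"
    using assms by (simp add: power2_eq_square)
  finally show ?thesis .
next
  case False
  then have "r\<^sup>2 \<le> x \<bullet> x"
    using assms by (simp add: dot_square_norm power_mono)
  then have "flat_exp 2 (1 - (x \<bullet> x) / r\<^sup>2) = 0"
    using assms by (simp add: flat_exp_def)
  then show ?thesis using assms by (simp add: grad_cutoff)
qed

lemma inverse_power_at_top_tendsto_0:
  "0 < n \<Longrightarrow> ((\<lambda>r::real. c / r ^ n) \<longlongrightarrow> 0) at_top"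
  by (intro tendsto_divide_0[OF tendsto_const] filterlim_at_top_imp_at_infinity
      filterlim_pow_at_top filterlim_ident)

lemma cutoff_measurable [measurable]: "cutoff r \<in> borel_measurable borel"
  unfolding cutoff_def[abs_def] by measurable

lemma grad_cutoff_measurable [measurable]: "grad (cutoff r) \<in> borel_measurable borel"
  unfolding grad_cutoff[abs_def] by measurable

lemma cutoff_tendsto: "((\<lambda>r. cutoff r x) \<longlongrightarrow> 1) at_top"
proof -
  have "((\<lambda>r. 1 - (x \<bullet> x) / r\<^sup>2) \<longlongrightarrow> 1 - 0) at_top"
    by (intro tendsto_diff tendsto_const inverse_power_at_top_tendsto_0) simp
  moreover have "isCont (flat_exp 0) 1"
    using DERIV_isCont flat_exp_has_derivative by blast
  ultimately have "((\<lambda>r. flat_exp 0 (1 - (x \<bullet> x) / r\<^sup>2)) \<longlongrightarrow> flat_exp 0 1) at_top"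
    by (auto intro: isCont_tendsto_compose)
  from tendsto_mult_left[OF this, of "exp 1"] show ?thesis
    by (simp add: cutoff_def flat_exp_def exp_minus)
qed

lemma grad_cutoff_tendsto: "((\<lambda>r. grad (cutoff r) x) \<longlongrightarrow> 0) at_top"
proof (rule Lim_null_comparison)
  show "\<forall>\<^sub>F r in at_top. norm (grad (cutoff r) x) \<le> 4 * exp 1 / r ^ 1"
    using eventually_gt_at_top[of "0::real"] by eventually_elim (simp add: norm_grad_cutoff_le)
qed (rule inverse_power_at_top_tendsto_0, simp)

text \<open>Because \<open>flat_exp 0 (r * y)\<close> is \<open>exp (- 1 / (r * y))\<close> for \<open>y > 0\<close>, which tends to \<open>1\<close>, and vanishes otherwise,
  these products are test functions that converge boundedly to the indicator of an open box.\<close>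

definition box_bump :: "'a::euclidean_space \<Rightarrow> 'a \<Rightarrow> real \<Rightarrow> 'a \<Rightarrow> real" where
  "box_bump l u r x = (\<Prod>b\<in>Basis. flat_exp 0 (r * ((x - l) \<bullet> b)) * flat_exp 0 (r * ((u - x) \<bullet> b)))"

lemma test_function_box_bump:
  assumes "0 < r"
  shows "test_function (box_bump l u r :: 'a::euclidean_space \<Rightarrow> real)"
proof (rule test_function_bounded_support)
  have *: "Ck k (\<lambda>x::'a. r * (x \<bullet> b - l \<bullet> b))" "Ck k (\<lambda>x::'a. r * (u \<bullet> b - x \<bullet> b))" for k b
    by (intro Ck_mult Ck_const Ck_diff Ck_inner)+
  show "Ck k (box_bump l u r)" for k
    unfolding box_bump_def[abs_def] inner_diff_left
    by (intro Ck_prod Ck_mult Ck_flat_exp_compose * finite_Basis)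
  show "compact (cbox l u)" by simp
  show "x \<in> cbox l u" if "box_bump l u r x \<noteq> 0" for x :: 'a
    using that assms
    by (auto simp: box_bump_def mem_box flat_exp_def inner_diff_left mult_le_0_iff split: if_splits)
qed

lemma box_bump_nonneg: "0 \<le> box_bump l u r x"
  unfolding box_bump_def by (auto intro!: prod_nonneg simp: flat_exp_bounds)

lemma box_bump_le_1: "box_bump l u r x \<le> 1"
  unfolding box_bump_def by (auto intro!: prod_le_1 mult_le_one simp: flat_exp_bounds)

lemma flat_exp_0_tendsto: "((\<lambda>r. flat_exp 0 (r * y)) \<longlongrightarrow> indicator {0<..} y) at_top"
proof (cases "y > 0")
  case True
  have "((\<lambda>r. exp (- (inverse y / r ^ 1))) \<longlongrightarrow> exp (- 0)) at_top"
    by (intro tendsto_intros inverse_power_at_top_tendsto_0) simp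
  then have "((\<lambda>r. flat_exp 0 (r * y)) \<longlongrightarrow> exp (- 0)) at_top"
  proof (rule Lim_transform_eventually)
    show "\<forall>\<^sub>F r in at_top. exp (- (inverse y / r ^ 1)) = flat_exp 0 (r * y)"
      using eventually_gt_at_top[of "0::real"] by eventually_elim
        (use True in \<open>simp add: flat_exp_def mult_le_0_iff divide_inverse mult.commute\<close>)
  qed
  then show ?thesis using True by simp
next
  case False
  have "\<forall>\<^sub>F r in at_top. 0 = flat_exp 0 (r * y)"
    using eventually_gt_at_top[of "0::real"] by eventually_elim
      (use False in \<open>simp add: flat_exp_def mult_nonneg_nonpos\<close>)
  then show ?thesis using False
    by (auto intro: Lim_transform_eventually[OF tendsto_const])
qed

lemma box_bump_measurable [measurable]: "box_bump l u r \<in> borel_measurable borel"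
  unfolding box_bump_def[abs_def] by measurable

lemma box_bump_tendsto: "((\<lambda>r. box_bump l u r x) \<longlongrightarrow> indicator (box l u) x) at_top"
proof -
  have "((\<lambda>r. box_bump l u r x) \<longlongrightarrow>
      (\<Prod>b\<in>Basis. indicator {0<..} ((x - l) \<bullet> b) * indicator {0<..} ((u - x) \<bullet> b))) at_top"
    unfolding box_bump_def by (intro tendsto_prod tendsto_mult flat_exp_0_tendsto)
  also have "(\<Prod>b\<in>Basis. indicator {0<..} ((x - l) \<bullet> b) * indicator {0<..} ((u - x) \<bullet> b)) =
      (indicator (box l u) x :: real)"
    by (auto simp: indicator_def mem_box inner_diff_left)
  finally show ?thesis .
qed

section \<open>Weak gradients\<close>

lemma test_function_Ck: "test_function \<psi> \<Longrightarrow> Ck k \<psi>"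
  by (simp add: test_function_def)

lemma test_function_differentiable: "test_function \<psi> \<Longrightarrow> \<psi> differentiable (at x)"
  using test_function_Ck Ck_differentiable by blast

lemma test_function_continuous: "test_function \<psi> \<Longrightarrow> continuous_on UNIV \<psi>"
  using test_function_Ck Ck_continuous by blast

lemma test_function_continuous_grad: "test_function \<psi> \<Longrightarrow> continuous_on UNIV (grad \<psi>)"
  using test_function_Ck continuous_on_grad by blast

lemma test_function_support:
  assumes "test_function \<psi>"
  obtains K where "compact K" "\<And>x. x \<notin> K \<Longrightarrow> \<psi> x = 0" "\<And>x. x \<notin> K \<Longrightarrow> grad \<psi> x = 0"
proof
  let ?K = "closure {x. \<psi> x \<noteq> 0}"
  show "compact ?K" using assms by (simp add: test_function_def)
  show zero: "\<psi> x = 0" if "x \<notin> ?K" for x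
    using that closure_subset[of "{x. \<psi> x \<noteq> 0}"] by blast
  show "grad \<psi> x = 0" if "x \<notin> ?K" for x
  proof -
    have "((\<lambda>_. 0) has_derivative (\<lambda>_. 0)) (at x)" by simp
    then have "(\<psi> has_derivative (\<lambda>_. 0)) (at x)"
      by (rule has_derivative_transform_within_open[where s="- ?K"])
         (use that in \<open>auto simp only: open_Compl closed_closure Compl_iff intro!: zero[symmetric]\<close>)
    then have "frechet_derivative \<psi> (at x) = (\<lambda>_. 0)"
      using frechet_derivative_at by metis
    then show ?thesis by (simp add: grad_def)
  qed
qed

lemma bounded_compact_support:
  fixes f :: "'a::topological_space \<Rightarrow> 'b::real_normed_vector"
  assumes "continuous_on UNIV f" "compact K" "\<And>x. x \<notin> K \<Longrightarrow> f x = 0"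
  obtains B where "0 < B" "\<And>x. norm (f x) \<le> B"
proof -
  have "compact (f ` K)"
    using assms by (meson compact_continuous_image continuous_on_subset subset_UNIV)
  then obtain B where B: "0 < B" "\<And>y. y \<in> f ` K \<Longrightarrow> norm y \<le> B"
    by (meson compact_imp_bounded bounded_pos)
  have "norm (f x) \<le> B" for x
    using B assms(3) by (cases "x \<in> K") auto
  with B(1) show ?thesis by (rule that)
qed

lemma test_function_bounded:
  assumes "test_function \<psi>"
  obtains B where "0 < B" "\<And>x. \<bar>\<psi> x\<bar> \<le> B" "\<And>x. norm (grad \<psi> x) \<le> B"
proof -
  obtain K where K: "compact K" "\<And>x. x \<notin> K \<Longrightarrow> \<psi> x = 0" "\<And>x. x \<notin> K \<Longrightarrow> grad \<psi> x = 0"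
    using test_function_support[OF assms] by blast
  obtain B1 where "0 < B1" "\<And>x. norm (\<psi> x) \<le> B1"
    using bounded_compact_support[OF test_function_continuous[OF assms] K(1) K(2)] by blast
  moreover obtain B2 where "0 < B2" "\<And>x. norm (grad \<psi> x) \<le> B2"
    using bounded_compact_support[OF test_function_continuous_grad[OF assms] K(1) K(3)] by blast
  ultimately show ?thesis
    by (intro that[of "max B1 B2"]) (auto simp: le_max_iff_disj)
qed

lemma locally_integrable_measurable:
  fixes u :: "'a::euclidean_space \<Rightarrow> 'b::euclidean_space"
  assumes "\<And>K. compact K \<Longrightarrow> set_integrable lborel K u"
  shows "u \<in> borel_measurable borel"
proof (rule borel_measurable_LIMSEQ_metric)
  show "(\<lambda>x. indicator (cball 0 (real n)) x *\<^sub>R u x) \<in> borel_measurable borel" for n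
    using assms[of "cball 0 (real n)"] unfolding set_integrable_def
    by (simp add: borel_measurable_integrable)
  show "(\<lambda>n. indicator (cball 0 (real n)) x *\<^sub>R u x) \<longlonglongrightarrow> u x" for x
  proof (rule tendsto_eventually)
    obtain N :: nat where N: "norm x \<le> real N" using real_arch_simple by blast
    show "\<forall>\<^sub>F n in sequentially. indicator (cball 0 (real n)) x *\<^sub>R u x = u x"
      using eventually_ge_at_top[of N] by eventually_elim (use N in auto)
  qed
qed

lemma locally_integrable_mult:
  fixes u :: "'a::euclidean_space \<Rightarrow> 'b::euclidean_space"
  assumes u: "\<And>K. compact K \<Longrightarrow> set_integrable lborel K u"
    and f: "continuous_on UNIV f" "compact K" "\<And>x. x \<notin> K \<Longrightarrow> f x = 0"
  shows "integrable lborel (\<lambda>x. (f x :: real) *\<^sub>R u x)"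
proof -
  obtain B where B: "0 < B" "\<And>x. norm (f x) \<le> B"
    using bounded_compact_support[OF f(1-3)] by blast
  have [measurable]: "u \<in> borel_measurable borel" "f \<in> borel_measurable borel"
    using locally_integrable_measurable[OF u] borel_measurable_continuous_onI[OF f(1)] by auto
  show ?thesis
  proof (rule Bochner_Integration.integrable_bound)
    show "integrable lborel (\<lambda>x. B *\<^sub>R (indicator K x *\<^sub>R u x))"
      using u[OF f(2)] by (intro integrable_scaleR_right) (simp add: set_integrable_def)
    show "AE x in lborel. norm (f x *\<^sub>R u x) \<le> norm (B *\<^sub>R (indicator K x *\<^sub>R u x))"
    proof (rule AE_I2)
      show "norm (f x *\<^sub>R u x) \<le> norm (B *\<^sub>R (indicator K x *\<^sub>R u x))" for x
        using B f(3)[of x] by (cases "x \<in> K") (auto intro: mult_right_mono)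
    qed
  qed simp
qed

lemma continuous_locally_integrable:
  fixes f :: "'a::euclidean_space \<Rightarrow> 'b::euclidean_space"
  assumes "continuous_on UNIV f" "compact K"
  shows "set_integrable lborel K f"
  unfolding set_integrable_def
  using assms by (intro borel_integrable_compact) (auto intro: continuous_on_subset)

lemma integrable_compact_support:
  fixes f :: "'a::euclidean_space \<Rightarrow> real"
  assumes "continuous_on UNIV f" "compact K" "\<And>x. x \<notin> K \<Longrightarrow> f x = 0"
  shows "integrable lborel f"
  using locally_integrable_mult[OF continuous_locally_integrable[of "\<lambda>_. 1::real"] assms] by simp

text \<open>Translation invariance makes the integral of every difference quotient vanish; the quotients are
  bounded by the maximal slope and supported in a common compact set, so the limit can be taken under
  the integral.\<close>

lemma integral_directional_derivative_test_function:
  assumes "test_function f" "b \<in> Basis"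
  shows "(\<integral>x. frechet_derivative f (at x) b \<partial>lborel) = 0"
proof -
  obtain K where K: "compact K" "\<And>x. x \<notin> K \<Longrightarrow> f x = 0" "\<And>x. x \<notin> K \<Longrightarrow> grad f x = 0"
    using test_function_support[OF assms(1)] by blast
  obtain B where B: "0 < B" "\<And>x. \<bar>f x\<bar> \<le> B" "\<And>x. norm (grad f x) \<le> B"
    using test_function_bounded[OF assms(1)] by blast
  note cont = test_function_continuous[OF assms(1)]
  have df: "(f has_derivative (\<lambda>v. v \<bullet> grad f x)) (at x)" for x
    using GDERIV_grad[OF test_function_differentiable[OF assms(1)]] by (simp add: gderiv_def)
  have lip: "\<bar>f (x + s *\<^sub>R b) - f x\<bar> \<le> B * s" if "0 \<le> s" for x s
  proof -
    have "norm (f (x + s *\<^sub>R b) - f x) \<le> B * norm ((x + s *\<^sub>R b) - x)"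
    proof (rule differentiable_bound[OF convex_UNIV])
      show "onorm (\<lambda>v. v \<bullet> grad f y) \<le> B" for y
        using B(1) B(3)[of y]
        by (intro onorm_le) (metis Cauchy_Schwarz_ineq2 mult.commute mult_left_mono norm_ge_zero order_trans real_norm_def)
    qed (use df has_derivative_at_withinI in auto)
    then show ?thesis using that assms(2) by simp
  qed
  define s where "s n = inverse (real (Suc n))" for n
  have s: "0 < s n" "s n \<le> 1" for n by (auto simp: s_def inverse_le_1_iff)
  (* Steps have length at most 1, so K enlarged by the unit ball contains the supports
     of all difference quotients. *)
  define K' where "K' = (\<Union>x\<in>K. \<Union>y\<in>cball 0 1. {x + y})"
  have "compact K'"
    using compact_sums'[OF K(1) compact_cball[of 0 1]] by (simp add: K'_def)
  have [measurable]: "f \<in> borel_measurable borel" "grad f \<in> borel_measurable borel" "K' \<in> sets borel"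
    using cont test_function_continuous_grad[OF assms(1)] \<open>compact K'\<close>
    by (auto intro: borel_measurable_continuous_onI compact_imp_closed borel_closed)
  have int_f: "integrable lborel f"
    using integrable_compact_support[OF cont K(1,2)] .
  define q where "q n x = (f (x + s n *\<^sub>R b) - f x) / s n" for n x
  have "(\<lambda>n. \<integral>x. q n x \<partial>lborel) \<longlonglongrightarrow> (\<integral>x. b \<bullet> grad f x \<partial>lborel)"
  proof (rule integral_dominated_convergence)
    show "integrable lborel (\<lambda>x. B * indicator K' x)"
      using emeasure_compact_finite[OF \<open>compact K'\<close>] by (intro integrable_mult_right) simp
    show "AE x in lborel. (\<lambda>n. q n x) \<longlonglongrightarrow> b \<bullet> grad f x"
    proof (rule AE_I2)
      fix x
      have "((\<lambda>r. f (x + r *\<^sub>R b)) has_derivative (\<lambda>r. (r *\<^sub>R b) \<bullet> grad f x)) (at 0)"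
        by (rule has_derivative_compose[where f="\<lambda>r. x + r *\<^sub>R b"])
           (auto intro!: derivative_eq_intros df)
      then have "((\<lambda>r. f (x + r *\<^sub>R b)) has_real_derivative (b \<bullet> grad f x)) (at 0)"
        by (simp add: has_field_derivative_def mult.commute[of _ "b \<bullet> _"])
      then have "((\<lambda>r. (f (x + r *\<^sub>R b) - f x) / r) \<longlongrightarrow> b \<bullet> grad f x) (at 0)"
        by (simp add: DERIV_def)
      moreover have "filterlim s (at 0) sequentially"
        unfolding filterlim_at
      proof
        show "\<forall>\<^sub>F n in sequentially. s n \<in> UNIV \<and> s n \<noteq> 0"
          using s(1) by (simp add: less_imp_neq[symmetric])
        show "s \<longlonglongrightarrow> 0"
          using LIMSEQ_inverse_real_of_nat by (simp add: s_def[abs_def])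
      qed
      ultimately show "(\<lambda>n. q n x) \<longlonglongrightarrow> b \<bullet> grad f x"
        unfolding q_def by (rule filterlim_compose)
    qed
    show "AE x in lborel. norm (q n x) \<le> B * indicator K' x" for n
    proof (rule AE_I2)
      fix x
      show "norm (q n x) \<le> B * indicator K' x"
      proof (cases "x \<in> K'")
        case True
        then show ?thesis
          using lip[of "s n" x] s[of n] by (simp add: q_def field_simps)
      next
        case False
        have "x \<notin> K"
        proof
          assume "x \<in> K"
          then have "x \<in> K'"
            unfolding K'_def by (intro UN_I[of x] UN_I[of 0]) auto
          with False show False by simp
        qed
        moreover have "x + s n *\<^sub>R b \<notin> K"
        proof
          assume "x + s n *\<^sub>R b \<in> K"
          then have "x \<in> K'"
            using s[of n] assms(2) unfolding K'_def
            by (intro UN_I[of "x + s n *\<^sub>R b"] UN_I[of "- (s n *\<^sub>R b)"]) auto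
          with False show False by simp
        qed
        ultimately show ?thesis using B(1) by (simp add: q_def K)
      qed
    qed
  qed (auto simp: q_def)
  moreover have "(\<integral>x. q n x \<partial>lborel) = 0" for n
  proof -
    have eq: "(\<integral>x. f (x + s n *\<^sub>R b) \<partial>lborel) = (\<integral>x. f x \<partial>lborel)"
      by (subst (2) lborel_distr_plus[of "s n *\<^sub>R b", symmetric]) (simp add: integral_distr add.commute)
    have "integrable (distr lborel borel ((+) (s n *\<^sub>R b))) f"
      using int_f by (simp add: lborel_distr_plus)
    then have "integrable lborel (\<lambda>x. f (x + s n *\<^sub>R b))"
      by (subst (asm) integrable_distr_eq) (auto simp: add.commute)
    then show ?thesis unfolding q_def using int_f eq by simp
  qed
  ultimately have "(\<integral>x. b \<bullet> grad f x \<partial>lborel) = 0"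
    by (simp add: LIMSEQ_const_iff)
  then show ?thesis
    using inner_grad[OF test_function_differentiable[OF assms(1)]] by simp
qed

lemma frechet_derivative_mult_test_function:
  assumes "test_function \<psi>" "test_function \<kappa>"
  shows "frechet_derivative (\<lambda>x. \<psi> x * \<kappa> x) (at x) b =
    \<psi> x * frechet_derivative \<kappa> (at x) b + frechet_derivative \<psi> (at x) b * \<kappa> x"
proof -
  have "((\<lambda>x. \<psi> x * \<kappa> x) has_derivative (\<lambda>b. \<psi> x * frechet_derivative \<kappa> (at x) b
      + frechet_derivative \<psi> (at x) b * \<kappa> x)) (at x)"
    using assms by (intro has_derivative_mult)
      (auto simp: frechet_derivative_works[symmetric] test_function_differentiable)
  from fun_cong[OF frechet_derivative_at[OF this], symmetric] show ?thesis .
qed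

lemma integrable_test_function_mult:
  fixes u :: "'a::euclidean_space \<Rightarrow> real"
  assumes "\<And>K. compact K \<Longrightarrow> set_integrable lborel K u" "test_function \<psi>"
  shows "integrable lborel (\<lambda>x. \<psi> x * u x)"
    and "integrable lborel (\<lambda>x. frechet_derivative \<psi> (at x) b * u x)"
proof -
  obtain K where K: "compact K" "\<And>x. x \<notin> K \<Longrightarrow> \<psi> x = 0" "\<And>x. x \<notin> K \<Longrightarrow> grad \<psi> x = 0"
    using test_function_support[OF assms(2)] by blast
  show "integrable lborel (\<lambda>x. \<psi> x * u x)"
    using locally_integrable_mult[OF assms(1) test_function_continuous[OF assms(2)] K(1,2)] by simp
  have "continuous_on UNIV (\<lambda>x. b \<bullet> grad \<psi> x)"
    using test_function_continuous_grad[OF assms(2)] by (intro continuous_intros)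
  from locally_integrable_mult[OF assms(1) this K(1)] K(3)
  show "integrable lborel (\<lambda>x. frechet_derivative \<psi> (at x) b * u x)"
    using inner_grad[OF test_function_differentiable[OF assms(2)]] by simp
qed

lemma weak_gradient_test_function:
  assumes "test_function \<psi>"
  shows "weak_gradient \<psi> (grad \<psi>)"
  unfolding weak_gradient_def
proof (intro conjI allI impI ballI)
  note cont = test_function_continuous[OF assms] test_function_continuous_grad[OF assms]
  show "set_integrable lborel K \<psi>" "set_integrable lborel K (grad \<psi>)" if "compact K" for K
    using that cont continuous_locally_integrable by blast+
  fix \<kappa> b assume \<kappa>: "test_function (\<kappa> :: 'a \<Rightarrow> real)" and b: "b \<in> (Basis :: 'a set)"
  have d: "frechet_derivative \<psi> (at x) b = grad \<psi> x \<bullet> b" for x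
    using inner_grad[OF test_function_differentiable[OF assms]] by (simp add: inner_commute)
  have "integrable lborel (\<lambda>x. \<psi> x * frechet_derivative \<kappa> (at x) b)"
    using integrable_test_function_mult(2)[OF continuous_locally_integrable[OF cont(1)] \<kappa>]
    by (simp add: mult.commute)
  moreover have "integrable lborel (\<lambda>x. (grad \<psi> x \<bullet> b) * \<kappa> x)"
    using integrable_test_function_mult(2)[of \<kappa> \<psi> b] assms \<kappa>
      continuous_locally_integrable test_function_continuous
    unfolding d by blast
  moreover have "(\<integral>x. \<psi> x * frechet_derivative \<kappa> (at x) b + (grad \<psi> x \<bullet> b) * \<kappa> x \<partial>lborel) = 0"
    using integral_directional_derivative_test_function[OF test_function_mult[OF assms \<kappa>] b]
    by (simp add: frechet_derivative_mult_test_function[OF assms \<kappa>] d)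
  ultimately show "(\<integral>x. \<psi> x * frechet_derivative \<kappa> (at x) b \<partial>lborel) = - (\<integral>x. (grad \<psi> x \<bullet> b) * \<kappa> x \<partial>lborel)"
    by simp
qed

lemma set_integrable_lborel_mult:
  fixes u :: "'a::euclidean_space \<Rightarrow> 'b::euclidean_space" and f :: "'a \<Rightarrow> real"
  assumes u: "set_integrable lborel K u"
    and f: "continuous_on UNIV f" "\<And>x. \<bar>f x\<bar> \<le> B"
  shows "set_integrable lborel K (\<lambda>x. f x *\<^sub>R u x)"
proof -
  have [measurable]: "f \<in> borel_measurable borel"
    using f(1) by (rule borel_measurable_continuous_onI)
  have [measurable]: "(\<lambda>x. indicator K x *\<^sub>R u x) \<in> borel_measurable lborel"
    using u unfolding set_integrable_def by (rule borel_measurable_integrable)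
  have "integrable lborel (\<lambda>x. f x *\<^sub>R (indicator K x *\<^sub>R u x))"
  proof (rule Bochner_Integration.integrable_bound
      [OF integrable_scaleR_right[OF u[unfolded set_integrable_def], of B]])
    have "\<bar>f x\<bar> \<le> \<bar>B\<bar>" for x using f(2)[of x] by linarith
    then show "AE x in lborel. norm (f x *\<^sub>R (indicator K x *\<^sub>R u x)) \<le> norm (B *\<^sub>R (indicator K x *\<^sub>R u x))"
      unfolding norm_scaleR[of "f _"] norm_scaleR[of B] by (intro AE_I2 mult_right_mono) auto
  qed (rule borel_measurable_scaleR; measurable)
  then show ?thesis
    unfolding set_integrable_def by (simp add: mult.commute)
qed

text \<open>Apply the defining identity of the weak gradient of \<open>u\<close> to the test function \<open>\<kappa> * \<psi>\<close> and move the
  term with the derivative of \<open>\<kappa>\<close> to the other side.\<close>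

lemma weak_gradient_mult_test_function:
  fixes u :: "'a::euclidean_space \<Rightarrow> real"
  assumes wg: "weak_gradient u g" and \<kappa>: "test_function \<kappa>"
  shows "weak_gradient (\<lambda>x. \<kappa> x * u x) (\<lambda>x. \<kappa> x *\<^sub>R g x + u x *\<^sub>R grad \<kappa> x)"
  unfolding weak_gradient_def
proof (intro conjI allI impI ballI)
  have u: "set_integrable lborel K u" and g: "set_integrable lborel K g" if "compact K" for K
    using wg that by (auto simp: weak_gradient_def)
  obtain B where "0 < B" and B: "\<And>x. \<bar>\<kappa> x\<bar> \<le> B" "\<And>x. norm (grad \<kappa> x) \<le> B"
    using test_function_bounded[OF \<kappa>] by blast
  note cont = test_function_continuous[OF \<kappa>] test_function_continuous_grad[OF \<kappa>]
  have d: "frechet_derivative \<kappa> (at x) b = grad \<kappa> x \<bullet> b" for x b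
    using inner_grad[OF test_function_differentiable[OF \<kappa>]] by (simp add: inner_commute)
  show "set_integrable lborel K (\<lambda>x. \<kappa> x * u x)" if "compact K" for K
    using set_integrable_lborel_mult[OF u[OF that] cont(1) B(1)] by simp
  show "set_integrable lborel K (\<lambda>x. \<kappa> x *\<^sub>R g x + u x *\<^sub>R grad \<kappa> x)" if "compact K" for K
  proof (rule set_integral_add(1))
    show "set_integrable lborel K (\<lambda>x. \<kappa> x *\<^sub>R g x)"
      using set_integrable_lborel_mult[OF g[OF that] cont(1) B(1)] by simp
    have [measurable]: "grad \<kappa> \<in> borel_measurable borel"
      using cont(2) by (rule borel_measurable_continuous_onI)
    have [measurable]: "(\<lambda>x. indicator K x *\<^sub>R u x) \<in> borel_measurable lborel"
      using u[OF that] unfolding set_integrable_def by (rule borel_measurable_integrable)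
    have "integrable lborel (\<lambda>x. (indicator K x *\<^sub>R u x) *\<^sub>R grad \<kappa> x)"
    proof (rule Bochner_Integration.integrable_bound
        [OF integrable_scaleR_right[OF u[OF that, unfolded set_integrable_def], of B]])
      show "AE x in lborel. norm ((indicator K x *\<^sub>R u x) *\<^sub>R grad \<kappa> x) \<le> norm (B *\<^sub>R (indicator K x *\<^sub>R u x))"
      proof (rule AE_I2)
        fix x
        have "norm (grad \<kappa> x) \<le> \<bar>B\<bar>" using B(2)[of x] by linarith
        then have "\<bar>indicator K x * u x\<bar> * norm (grad \<kappa> x) \<le> \<bar>indicator K x * u x\<bar> * \<bar>B\<bar>"
          by (intro mult_left_mono) auto
        then show "norm ((indicator K x *\<^sub>R u x) *\<^sub>R grad \<kappa> x) \<le> norm (B *\<^sub>R (indicator K x *\<^sub>R u x))"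
          by (simp add: abs_mult mult_ac)
      qed
    qed (rule borel_measurable_scaleR; measurable)
    then show "set_integrable lborel K (\<lambda>x. u x *\<^sub>R grad \<kappa> x)"
      unfolding set_integrable_def by simp
  qed
  fix \<psi> b assume \<psi>: "test_function (\<psi> :: 'a \<Rightarrow> real)" and b: "b \<in> (Basis :: 'a set)"
  have \<kappa>\<psi>: "test_function (\<lambda>x. \<kappa> x * \<psi> x)" using \<kappa> \<psi> by (rule test_function_mult)
  have g': "set_integrable lborel K (\<lambda>x. g x \<bullet> b)" if "compact K" for K
    using g[OF that] integrable_inner_left[of b lborel "\<lambda>x. indicator K x *\<^sub>R g x"]
    unfolding set_integrable_def by simp
  have "(\<integral>x. u x * frechet_derivative (\<lambda>x. \<kappa> x * \<psi> x) (at x) b \<partial>lborel)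
      = - (\<integral>x. (g x \<bullet> b) * (\<kappa> x * \<psi> x) \<partial>lborel)"
    using wg \<kappa>\<psi> b unfolding weak_gradient_def by blast
  then have *: "(\<integral>x. \<kappa> x * u x * frechet_derivative \<psi> (at x) b + u x * (grad \<kappa> x \<bullet> b) * \<psi> x \<partial>lborel)
      = - (\<integral>x. (g x \<bullet> b) * (\<kappa> x * \<psi> x) \<partial>lborel)"
    by (simp add: frechet_derivative_mult_test_function[OF \<kappa> \<psi>] d algebra_simps)
  have i1: "integrable lborel (\<lambda>x. \<kappa> x * u x * frechet_derivative \<psi> (at x) b)"
    using integrable_test_function_mult(2)[OF _ \<psi>, of "\<lambda>x. \<kappa> x * u x"]
      set_integrable_lborel_mult[OF u cont(1) B(1)]
    by (simp add: mult_ac)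
  have i3: "integrable lborel (\<lambda>x. (g x \<bullet> b) * (\<kappa> x * \<psi> x))"
    using integrable_test_function_mult(1)[OF g' \<kappa>\<psi>] by (simp add: mult_ac)
  obtain B' where "0 < B'" and B': "\<And>x. \<bar>\<psi> x\<bar> \<le> B'" "\<And>x. norm (grad \<psi> x) \<le> B'"
    using test_function_bounded[OF \<psi>] by blast
  have "set_integrable lborel K (\<lambda>x. \<psi> x * u x)" if "compact K" for K
    using set_integrable_lborel_mult[OF u[OF that] test_function_continuous[OF \<psi>] B'(1)] by simp
  from integrable_test_function_mult(2)[OF this \<kappa>, of b]
  have i2: "integrable lborel (\<lambda>x. u x * (grad \<kappa> x \<bullet> b) * \<psi> x)"
    by (simp add: mult_ac d)
  have "(\<integral>x. \<kappa> x * u x * frechet_derivative \<psi> (at x) b \<partial>lborel) =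
      - ((\<integral>x. (g x \<bullet> b) * (\<kappa> x * \<psi> x) \<partial>lborel) + (\<integral>x. u x * (grad \<kappa> x \<bullet> b) * \<psi> x \<partial>lborel))"
    using * i1 i2 by simp
  also have "\<dots> = - (\<integral>x. (g x \<bullet> b) * (\<kappa> x * \<psi> x) + u x * (grad \<kappa> x \<bullet> b) * \<psi> x \<partial>lborel)"
    using i2 i3 by simp
  finally show "(\<integral>x. \<kappa> x * u x * frechet_derivative \<psi> (at x) b \<partial>lborel) =
      - (\<integral>x. (\<kappa> x *\<^sub>R g x + u x *\<^sub>R grad \<kappa> x) \<bullet> b * \<psi> x \<partial>lborel)"
    by (simp add: algebra_simps inner_add_left)
qed

text \<open>Box bumps and cutoffs are test functions that converge boundedly to indicators of boxes and to \<open>1\<close>,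
  hence \<open>q\<close> integrates to \<open>0\<close> over all boxes and over the whole space. The sets over which it integrates to
  \<open>0\<close> then include the sigma-algebra generated by the boxes.\<close>

lemma fundamental_lemma:
  fixes q :: "'a::euclidean_space \<Rightarrow> real"
  assumes int: "integrable lborel q"
    and zero: "\<And>\<psi>. test_function \<psi> \<Longrightarrow> (\<integral>x. \<psi> x * q x \<partial>lborel) = 0"
  shows "AE x in lborel. q x = 0"
proof -
  have [measurable]: "q \<in> borel_measurable borel"
    using int borel_measurable_integrable by fastforce
  have limit_zero: "(\<integral>x. k x * q x \<partial>lborel) = 0"
    if tf: "\<And>r. 0 < r \<Longrightarrow> test_function (\<psi> r)"
      and le: "\<And>r x. \<bar>\<psi> r x\<bar> \<le> 1"
      and lim: "\<And>x. ((\<lambda>r. \<psi> r x) \<longlongrightarrow> k x) at_top"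
      and [measurable]: "\<And>r. \<psi> r \<in> borel_measurable borel"
      and [measurable]: "k \<in> borel_measurable borel"
    for \<psi> :: "real \<Rightarrow> 'a \<Rightarrow> real" and k
  proof -
    have "((\<lambda>r. \<integral>x. \<psi> r x * q x \<partial>lborel) \<longlongrightarrow> (\<integral>x. k x * q x \<partial>lborel)) at_top"
    proof (rule integral_dominated_convergence_at_top)
      show "integrable lborel (\<lambda>x. \<bar>q x\<bar>)" using int by simp
      show "\<forall>\<^sub>F r in at_top. AE x in lborel. norm (\<psi> r x * q x) \<le> \<bar>q x\<bar>"
        using le by (auto simp: abs_mult intro!: always_eventually mult_left_le_one_le)
    qed (auto intro!: lim tendsto_intros)
    moreover have "((\<lambda>r. \<integral>x. \<psi> r x * q x \<partial>lborel) \<longlongrightarrow> 0) at_top"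
      by (intro tendsto_eventually eventually_mono[OF eventually_gt_at_top[of "0::real"]] zero tf)
    ultimately show ?thesis
      using tendsto_unique[OF trivial_limit_at_top_linorder] by blast
  qed
  have total: "(\<integral>x. q x \<partial>lborel) = 0"
    using limit_zero[of cutoff "\<lambda>_. 1", OF test_function_cutoff _ cutoff_tendsto]
    by (simp add: cutoff_nonneg cutoff_le_1)
  have box: "(\<integral>x. indicator (box l u) x * q x \<partial>lborel) = 0" for l u :: 'a
    using limit_zero[of "box_bump l u", OF test_function_box_bump _ box_bump_tendsto]
    by (simp add: box_bump_nonneg box_bump_le_1)
  let ?G = "range (\<lambda>(a, b). box a b :: 'a set)"
  have si: "set_integrable lborel A q" if "A \<in> sets borel" for A
    using that int unfolding set_integrable_def by (intro integrable_mult_indicator) auto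
  have sets_G: "sets (borel :: 'a measure) = sigma_sets UNIV ?G"
    by (subst borel_eq_box) simp
  have "set_lebesgue_integral lborel A q = 0" if "A \<in> sets lborel" for A
  proof -
    have "Int_stable ?G"
      unfolding Int_stable_def by (auto simp: box_Int_box)
    moreover have "?G \<subseteq> Pow UNIV" by simp
    moreover have "A \<in> sigma_sets UNIV ?G" using that sets_G by simp
    ultimately show ?thesis
    proof (induction rule: sigma_sets_induct_disjoint)
      case (basic A)
      then show ?case using box by (auto simp: set_lebesgue_integral_def)
    next
      case (compl A)
      then have A: "A \<in> sets borel" using sets_G by simp
      have "set_lebesgue_integral lborel (UNIV - A) q =
          set_lebesgue_integral lborel UNIV q - set_lebesgue_integral lborel A q"
        using A set_integral_Un[of "UNIV - A" A lborel q] si[of A] si[of "UNIV - A"]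
        by (simp add: Diff_Int_distrib2)
      then show ?case using compl total by (simp add: set_lebesgue_integral_def)
    next
      case (union A)
      then have A: "range A \<subseteq> sets borel" using sets_G by simp
      have "set_lebesgue_integral lborel (\<Union>i. A i) q = (\<Sum>i. set_lebesgue_integral lborel (A i) q)"
      proof (rule lebesgue_integral_countable_add)
        show "A i \<inter> A j = {}" if "i \<noteq> j" for i j
          using union that by (auto simp: disjoint_family_on_def)
        show "set_integrable lborel (\<Union>i. A i) q" using A by (intro si) auto
      qed (use A in auto)
      then show ?case using union by simp
    qed (auto simp: set_lebesgue_integral_def)
  qed
  with int show ?thesis by (rule sigma_finite_measure.density_zero[OF lborel.sigma_finite_measure_axioms])
qed

section \<open>Differentiating integrals over a regular parametric family\<close>

lemma tendsto_integral_dominated: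
  fixes F :: "'a \<Rightarrow> 'b::metric_space \<Rightarrow> 'c::{banach, second_countable_topology}"
  assumes meas: "\<And>\<eta>. (\<lambda>x. F x \<eta>) \<in> borel_measurable M" "L \<in> borel_measurable M"
    and lim: "\<And>x. ((\<lambda>\<eta>. F x \<eta>) \<longlongrightarrow> L x) (at \<theta>)"
    and dom: "0 < \<epsilon>" "\<And>\<eta> x. \<eta> \<in> ball \<theta> \<epsilon> \<Longrightarrow> norm (F x \<eta>) \<le> w x" "integrable M w"
  shows "((\<lambda>\<eta>. \<integral>x. F x \<eta> \<partial>M) \<longlongrightarrow> (\<integral>x. L x \<partial>M)) (at \<theta>)"
  unfolding tendsto_at_iff_sequentially comp_def
proof (intro allI impI)
  fix X :: "nat \<Rightarrow> 'b" assume X: "\<forall>i. X i \<in> UNIV - {\<theta>}" "X \<longlonglongrightarrow> \<theta>"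
  then obtain N where N: "\<And>n. N \<le> n \<Longrightarrow> dist (X n) \<theta> < \<epsilon>"
    using dom(1) unfolding lim_sequentially by blast
  have "(\<lambda>n. \<integral>x. F x (X (n + N)) \<partial>M) \<longlonglongrightarrow> (\<integral>x. L x \<partial>M)"
  proof (rule integral_dominated_convergence[OF meas(2) meas(1) dom(3)])
    show "AE x in M. norm (F x (X (n + N))) \<le> w x" for n
      using N[of "n + N"] dom(2) by (simp add: dist_commute)
    have "(\<lambda>n. F x (X (n + N))) \<longlonglongrightarrow> L x" for x
      using lim[of x] X LIMSEQ_ignore_initial_segment[of "\<lambda>n. F x (X n)" "L x" N]
      unfolding tendsto_at_iff_sequentially comp_def by blast
    then show "AE x in M. (\<lambda>n. F x (X (n + N))) \<longlonglongrightarrow> L x" by simp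
  qed
  then show "(\<lambda>n. \<integral>x. F x (X n) \<partial>M) \<longlonglongrightarrow> (\<integral>x. L x \<partial>M)"
    by (rule LIMSEQ_offset)
qed

context
  fixes h :: "'a::euclidean_space \<Rightarrow> real" and \<rho> :: "'a \<Rightarrow> real^'m \<Rightarrow> real"
  assumes family: "regular_family h \<rho>"
begin

lemma family_pos: "0 < \<rho> x \<theta>"
  using family by (simp add: regular_family_def)

lemma family_integrable: "integrable lborel (\<lambda>x. \<rho> x \<theta>)" "(\<integral>x. \<rho> x \<theta> \<partial>lborel) = 1"
  using family by (auto simp: regular_family_def prob_density_def)

lemma family_measurable [measurable]: "(\<lambda>x. \<rho> x \<theta>) \<in> borel_measurable borel"
  using borel_measurable_integrable[OF family_integrable(1)] by simp

lemma family_cost_integrable: "integrable lborel (\<lambda>x. h x * \<rho> x \<theta>)"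
  using family by (simp add: regular_family_def)

lemma family_continuous: "continuous_on UNIV (\<lambda>(x, \<theta>). \<rho> x \<theta>)"
  using family by (simp add: regular_family_def)

lemma score_continuous: "continuous_on UNIV (score \<rho> x)"
  using family by (simp add: regular_family_def)

lemma log_has_derivative:
  "((\<lambda>\<eta>. ln (\<rho> x \<eta>)) has_derivative (\<lambda>v. v \<bullet> score \<rho> x \<theta>)) (at \<theta>)"
proof -
  have "(\<lambda>\<eta>. ln (\<rho> x \<eta>)) differentiable (at \<theta>)"
    using family by (simp add: regular_family_def)
  then show ?thesis
    using GDERIV_grad unfolding gderiv_def score_def by blast
qed

lemma density_has_derivative:
  "((\<lambda>\<eta>. \<rho> x \<eta>) has_derivative (\<lambda>v. (v \<bullet> score \<rho> x \<theta>) * \<rho> x \<theta>)) (at \<theta>)"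
proof -
  have "((\<lambda>\<eta>. exp (ln (\<rho> x \<eta>))) has_derivative (\<lambda>v. exp (ln (\<rho> x \<theta>)) * (v \<bullet> score \<rho> x \<theta>))) (at \<theta>)"
    using has_derivative_compose[OF log_has_derivative DERIV_exp[unfolded has_field_derivative_def]] .
  then show ?thesis by (simp add: family_pos mult.commute)
qed

lemma density_continuous: "isCont (\<lambda>\<eta>. \<rho> x \<eta>) \<theta>"
  using density_has_derivative has_derivative_continuous by blast

text \<open>The score in a direction is the limit of difference quotients of \<open>ln (\<rho> x \<cdot>)\<close>, each measurable in \<open>x\<close>.\<close>

lemma score_measurable [measurable]: "(\<lambda>x. score \<rho> x \<theta>) \<in> borel_measurable borel"
proof -
  have "(\<lambda>x. score \<rho> x \<theta> \<bullet> v) \<in> borel_measurable borel" for v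
  proof (rule borel_measurable_LIMSEQ_real)
    let ?s = "\<lambda>n. inverse (real (Suc n))"
    show "(\<lambda>x. (ln (\<rho> x (\<theta> + ?s n *\<^sub>R v)) - ln (\<rho> x \<theta>)) / ?s n) \<in> borel_measurable borel" for n
      by measurable
    show "(\<lambda>n. (ln (\<rho> x (\<theta> + ?s n *\<^sub>R v)) - ln (\<rho> x \<theta>)) / ?s n) \<longlonglongrightarrow> score \<rho> x \<theta> \<bullet> v" for x
    proof -
      have "((\<lambda>r. ln (\<rho> x (\<theta> + r *\<^sub>R v))) has_derivative (\<lambda>r. (r *\<^sub>R v) \<bullet> score \<rho> x \<theta>)) (at 0)"
        by (rule has_derivative_compose[where f="\<lambda>r. \<theta> + r *\<^sub>R v"])
           (auto intro!: derivative_eq_intros log_has_derivative)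
      then have "((\<lambda>r. ln (\<rho> x (\<theta> + r *\<^sub>R v))) has_real_derivative (v \<bullet> score \<rho> x \<theta>)) (at 0)"
        by (simp add: has_field_derivative_def mult.commute[of _ "v \<bullet> _"])
      then have "((\<lambda>r. (ln (\<rho> x (\<theta> + r *\<^sub>R v)) - ln (\<rho> x \<theta>)) / r) \<longlongrightarrow> score \<rho> x \<theta> \<bullet> v) (at 0)"
        by (simp add: DERIV_def inner_commute)
      moreover have "filterlim ?s (at 0) sequentially"
        using LIMSEQ_inverse_real_of_nat by (simp add: filterlim_at)
      ultimately show ?thesis by (rule filterlim_compose)
    qed
  qed
  then show ?thesis
    by (simp add: borel_measurable_euclidean_space[where f="\<lambda>x. score \<rho> x \<theta>"])
qed

lemma score_dominated:
  assumes "\<And>x. \<bar>f x\<bar> \<le> C * (1 + \<bar>h x\<bar>)"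
  obtains \<epsilon> w where "0 < \<epsilon>" "integrable lborel w"
    "\<And>\<eta> x. \<eta> \<in> ball \<theta> \<epsilon> \<Longrightarrow> \<bar>f x\<bar> * norm (score \<rho> x \<eta>) * \<rho> x \<eta> \<le> w x"
proof -
  obtain \<epsilon> w where *: "0 < \<epsilon>" "integrable lborel w"
    "\<forall>\<eta>\<in>ball \<theta> \<epsilon>. \<forall>x. (1 + \<bar>h x\<bar>) * norm (score \<rho> x \<eta>) * \<rho> x \<eta> \<le> w x"
    using family unfolding regular_family_def by blast
  show ?thesis
  proof (rule that[OF *(1) integrable_mult_right[OF *(2), of C]])
    fix \<eta> x assume \<eta>: "\<eta> \<in> ball \<theta> \<epsilon>"
    have "0 \<le> C * (1 + \<bar>h x\<bar>)" using assms[of x] by linarith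
    then have C: "0 \<le> C" unfolding zero_le_mult_iff by linarith
    have "\<bar>f x\<bar> * (norm (score \<rho> x \<eta>) * \<rho> x \<eta>) \<le> C * (1 + \<bar>h x\<bar>) * (norm (score \<rho> x \<eta>) * \<rho> x \<eta>)"
      using assms family_pos[of x \<eta>] by (intro mult_right_mono) auto
    also have "\<dots> \<le> C * w x"
      using * \<eta> C by (simp add: mult.assoc mult_left_mono)
    finally show "\<bar>f x\<bar> * norm (score \<rho> x \<eta>) * \<rho> x \<eta> \<le> C * w x" by (simp add: mult.assoc)
  qed
qed

lemma family_integrable_mult:
  assumes [measurable]: "f \<in> borel_measurable borel" and le: "\<And>x. \<bar>f x\<bar> \<le> C * (1 + \<bar>h x\<bar>)"
  shows "integrable lborel (\<lambda>x. f x * \<rho> x \<theta>)"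
proof (rule Bochner_Integration.integrable_bound)
  show "integrable lborel (\<lambda>x. C * (\<rho> x \<theta> + \<bar>h x * \<rho> x \<theta>\<bar>))"
    using family_integrable family_cost_integrable by (intro integrable_mult_right) simp
  show "AE x in lborel. norm (f x * \<rho> x \<theta>) \<le> norm (C * (\<rho> x \<theta> + \<bar>h x * \<rho> x \<theta>\<bar>))"
  proof (rule AE_I2)
    fix x
    have "norm (f x * \<rho> x \<theta>) \<le> C * (1 + \<bar>h x\<bar>) * \<rho> x \<theta>"
      using le[of x] family_pos[of x \<theta>] by (simp add: abs_mult mult_right_mono)
    also have "\<dots> = C * (\<rho> x \<theta> + \<bar>h x * \<rho> x \<theta>\<bar>)"
      using family_pos[of x \<theta>] by (simp add: abs_mult algebra_simps)
    finally show "norm (f x * \<rho> x \<theta>) \<le> norm (C * (\<rho> x \<theta> + \<bar>h x * \<rho> x \<theta>\<bar>))" by simp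
  qed
qed simp

lemma family_integrable_score:
  assumes [measurable]: "f \<in> borel_measurable borel" and le: "\<And>x. \<bar>f x\<bar> \<le> C * (1 + \<bar>h x\<bar>)"
  shows "integrable lborel (\<lambda>x. (f x * \<rho> x \<theta>) *\<^sub>R score \<rho> x \<theta>)"
proof -
  obtain \<epsilon> w where w: "0 < \<epsilon>" "integrable lborel w"
    "\<And>\<eta> x. \<eta> \<in> ball \<theta> \<epsilon> \<Longrightarrow> \<bar>f x\<bar> * norm (score \<rho> x \<eta>) * \<rho> x \<eta> \<le> w x"
    using score_dominated[OF le] by metis
  show ?thesis
  proof (rule Bochner_Integration.integrable_bound[OF w(2)])
    show "AE x in lborel. norm ((f x * \<rho> x \<theta>) *\<^sub>R score \<rho> x \<theta>) \<le> norm (w x)"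
    proof (rule AE_I2)
      fix x
      have "norm ((f x * \<rho> x \<theta>) *\<^sub>R score \<rho> x \<theta>) \<le> w x"
        using w(3)[of \<theta> x] w(1) family_pos[of x \<theta>] by (simp add: abs_mult mult_ac)
      then show "norm ((f x * \<rho> x \<theta>) *\<^sub>R score \<rho> x \<theta>) \<le> norm (w x)" by simp
    qed
  qed measurable
qed

text \<open>The local domination of \<open>(1 + \<bar>h\<bar>) * norm (score) * \<rho>\<close> bounds the gradient of \<open>f x * \<rho> x \<eta>\<close> on a ball
  around \<open>\<theta>\<close>. By the mean value inequality it also bounds the remainder of the first-order expansion,
  divided by \<open>norm (\<eta> - \<theta>)\<close>, and dominated convergence applies. The growth bound on \<open>f\<close> is what the cases
  \<open>f = 1\<close>, \<open>f = h\<close>, \<open>f\<close> a test function, and \<open>h\<close> times a test function have in common.\<close>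

lemma expectation_GDERIV:
  assumes [measurable]: "f \<in> borel_measurable borel" and le: "\<And>x. \<bar>f x\<bar> \<le> C * (1 + \<bar>h x\<bar>)"
  shows "GDERIV (\<lambda>\<eta>. \<integral>x. f x * \<rho> x \<eta> \<partial>lborel) \<theta> :> (\<integral>x. (f x * \<rho> x \<theta>) *\<^sub>R score \<rho> x \<theta> \<partial>lborel)"
  unfolding gderiv_def has_derivative_at_within
proof
  let ?D = "\<integral>x. (f x * \<rho> x \<theta>) *\<^sub>R score \<rho> x \<theta> \<partial>lborel"
  show "bounded_linear (\<lambda>v. v \<bullet> ?D)" by (rule bounded_linear_inner_left)
  obtain \<epsilon> w where w: "0 < \<epsilon>" "integrable lborel w"
    "\<And>\<eta> x. \<eta> \<in> ball \<theta> \<epsilon> \<Longrightarrow> \<bar>f x\<bar> * norm (score \<rho> x \<eta>) * \<rho> x \<eta> \<le> w x"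
    using score_dominated[OF le] by metis
  define R where "R x \<eta> = ((\<rho> x \<eta> - \<rho> x \<theta>) - ((\<eta> - \<theta>) \<bullet> score \<rho> x \<theta>) * \<rho> x \<theta>) / norm (\<eta> - \<theta>)" for x \<eta>
  have "((\<lambda>\<eta>. \<integral>x. f x * R x \<eta> \<partial>lborel) \<longlongrightarrow> (\<integral>x. (0::real) \<partial>(lborel::'a measure))) (at \<theta>)"
  proof (rule tendsto_integral_dominated[OF _ _ _ w(1)])
    show "integrable lborel (\<lambda>x. 2 * w x)" using w(2) by simp
    have "((\<lambda>\<eta>. R x \<eta>) \<longlongrightarrow> 0) (at \<theta>)" for x
      using density_has_derivative[of x \<theta>] unfolding has_derivative_at_within R_def
      by (simp add: divide_inverse mult.commute)
    from tendsto_mult_right_zero[OF this]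
    show "((\<lambda>\<eta>. f x * R x \<eta>) \<longlongrightarrow> 0) (at \<theta>)" for x .
    fix \<eta> x assume \<eta>: "\<eta> \<in> ball \<theta> \<epsilon>"
    have bd: "\<bar>f x * ((\<rho> x \<eta> - \<rho> x \<theta>) - ((\<eta> - \<theta>) \<bullet> score \<rho> x \<theta>) * \<rho> x \<theta>)\<bar> \<le> 2 * w x * norm (\<eta> - \<theta>)"
    proof -
      have a: "norm (f x * \<rho> x \<eta> - f x * \<rho> x \<theta>) \<le> w x * norm (\<eta> - \<theta>)"
      proof (rule differentiable_bound[OF convex_ball])
        show "((\<lambda>\<eta>. f x * \<rho> x \<eta>) has_derivative (\<lambda>v. f x * ((v \<bullet> score \<rho> x \<xi>) * \<rho> x \<xi>)))
            (at \<xi> within ball \<theta> \<epsilon>)" for \<xi>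
          by (intro has_derivative_mult_right has_derivative_at_withinI[OF density_has_derivative])
        show "onorm (\<lambda>v. f x * ((v \<bullet> score \<rho> x \<xi>) * \<rho> x \<xi>)) \<le> w x" if "\<xi> \<in> ball \<theta> \<epsilon>" for \<xi>
        proof (rule onorm_le)
          fix v
          have "norm (f x * ((v \<bullet> score \<rho> x \<xi>) * \<rho> x \<xi>)) = \<bar>f x\<bar> * \<rho> x \<xi> * \<bar>v \<bullet> score \<rho> x \<xi>\<bar>"
            using family_pos[of x \<xi>] by (simp add: abs_mult mult_ac)
          also have "\<dots> \<le> \<bar>f x\<bar> * \<rho> x \<xi> * (norm v * norm (score \<rho> x \<xi>))"
            using family_pos[of x \<xi>] Cauchy_Schwarz_ineq2 by (intro mult_left_mono) auto
          also have "\<dots> = (\<bar>f x\<bar> * norm (score \<rho> x \<xi>) * \<rho> x \<xi>) * norm v"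
            by (simp add: mult_ac)
          also have "\<dots> \<le> w x * norm v"
            using w(3)[OF that] by (intro mult_right_mono) auto
          finally show "norm (f x * ((v \<bullet> score \<rho> x \<xi>) * \<rho> x \<xi>)) \<le> w x * norm v" .
        qed
      qed (use \<eta> w(1) in auto)
      have "\<bar>f x * (((\<eta> - \<theta>) \<bullet> score \<rho> x \<theta>) * \<rho> x \<theta>)\<bar> = \<bar>f x\<bar> * \<rho> x \<theta> * \<bar>(\<eta> - \<theta>) \<bullet> score \<rho> x \<theta>\<bar>"
        using family_pos[of x \<theta>] by (simp add: abs_mult mult_ac)
      also have "\<dots> \<le> \<bar>f x\<bar> * \<rho> x \<theta> * (norm (\<eta> - \<theta>) * norm (score \<rho> x \<theta>))"
        using family_pos[of x \<theta>] Cauchy_Schwarz_ineq2 by (intro mult_left_mono) auto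
      also have "\<dots> = (\<bar>f x\<bar> * norm (score \<rho> x \<theta>) * \<rho> x \<theta>) * norm (\<eta> - \<theta>)"
        by (simp add: mult_ac)
      also have "\<dots> \<le> w x * norm (\<eta> - \<theta>)"
        using w(1) w(3)[of \<theta> x] by (intro mult_right_mono) auto
      finally have b: "\<bar>f x * (((\<eta> - \<theta>) \<bullet> score \<rho> x \<theta>) * \<rho> x \<theta>)\<bar> \<le> w x * norm (\<eta> - \<theta>)" .
      have "f x * ((\<rho> x \<eta> - \<rho> x \<theta>) - ((\<eta> - \<theta>) \<bullet> score \<rho> x \<theta>) * \<rho> x \<theta>) =
          (f x * \<rho> x \<eta> - f x * \<rho> x \<theta>) - f x * (((\<eta> - \<theta>) \<bullet> score \<rho> x \<theta>) * \<rho> x \<theta>)"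
        by (simp add: algebra_simps)
      then show ?thesis using a b unfolding real_norm_def by linarith
    qed
    show "norm (f x * R x \<eta>) \<le> 2 * w x"
    proof (cases "\<eta> = \<theta>")
      case False
      then show ?thesis using bd by (simp add: R_def abs_mult divide_simps)
    next
      case True
      have "0 \<le> \<bar>f x\<bar> * norm (score \<rho> x \<theta>) * \<rho> x \<theta>" using family_pos[of x \<theta>] by simp
      also have "\<dots> \<le> w x" using w(1) w(3)[of \<theta> x] by simp
      finally show ?thesis using True by (simp add: R_def)
    qed
  qed (auto simp: R_def)
  moreover have "(\<integral>x. f x * R x \<eta> \<partial>lborel) =
      ((\<integral>x. f x * \<rho> x \<eta> \<partial>lborel) - (\<integral>x. f x * \<rho> x \<theta> \<partial>lborel) - (\<eta> - \<theta>) \<bullet> ?D) /\<^sub>R norm (\<eta> - \<theta>)" for \<eta>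
  proof -
    have i: "integrable lborel (\<lambda>x. f x * \<rho> x \<eta>)" for \<eta>
      by (rule family_integrable_mult[OF assms])
    note i' = family_integrable_score[OF assms, of \<theta>]
    have "(\<integral>x. f x * R x \<eta> \<partial>lborel) =
       (\<integral>x. (f x * \<rho> x \<eta> - f x * \<rho> x \<theta> - (\<eta> - \<theta>) \<bullet> ((f x * \<rho> x \<theta>) *\<^sub>R score \<rho> x \<theta>)) / norm (\<eta> - \<theta>) \<partial>lborel)"
      unfolding R_def by (intro Bochner_Integration.integral_cong) (auto simp: algebra_simps)
    also have "\<dots> = ((\<integral>x. f x * \<rho> x \<eta> \<partial>lborel) - (\<integral>x. f x * \<rho> x \<theta> \<partial>lborel) - (\<eta> - \<theta>) \<bullet> ?D) / norm (\<eta> - \<theta>)"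
      using i i' integrable_inner_right[OF i', of "\<eta> - \<theta>"] integral_inner_right[OF i', of "\<eta> - \<theta>"] by simp
    finally show ?thesis by (simp add: divide_inverse mult.commute)
  qed
  ultimately show "((\<lambda>y. ((\<integral>x. f x * \<rho> x y \<partial>lborel) - (\<integral>x. f x * \<rho> x \<theta> \<partial>lborel) - (y - \<theta>) \<bullet> ?D) /\<^sub>R norm (y - \<theta>)) \<longlongrightarrow> 0) (at \<theta>)"
    by simp
qed

lemma expectation_gradient_continuous:
  assumes [measurable]: "f \<in> borel_measurable borel" and le: "\<And>x. \<bar>f x\<bar> \<le> C * (1 + \<bar>h x\<bar>)"
  shows "continuous_on UNIV (\<lambda>\<theta>. \<integral>x. (f x * \<rho> x \<theta>) *\<^sub>R score \<rho> x \<theta> \<partial>lborel)"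
proof (intro continuous_at_imp_continuous_on ballI)
  fix \<theta> :: "real^'m"
  obtain \<epsilon> w where w: "0 < \<epsilon>" "integrable lborel w"
    "\<And>\<eta> x. \<eta> \<in> ball \<theta> \<epsilon> \<Longrightarrow> \<bar>f x\<bar> * norm (score \<rho> x \<eta>) * \<rho> x \<eta> \<le> w x"
    using score_dominated[OF le] by metis
  show "isCont (\<lambda>\<theta>. \<integral>x. (f x * \<rho> x \<theta>) *\<^sub>R score \<rho> x \<theta> \<partial>lborel) \<theta>"
    unfolding isCont_def
  proof (rule tendsto_integral_dominated[OF _ _ _ w(1) _ w(2)])
    show "((\<lambda>\<eta>. (f x * \<rho> x \<eta>) *\<^sub>R score \<rho> x \<eta>) \<longlongrightarrow> (f x * \<rho> x \<theta>) *\<^sub>R score \<rho> x \<theta>) (at \<theta>)" for x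
      using density_continuous[of \<theta> x] score_continuous[of x]
      by (intro tendsto_intros) (auto simp: isCont_def continuous_on_def)
    show "norm ((f x * \<rho> x \<eta>) *\<^sub>R score \<rho> x \<eta>) \<le> w x" if "\<eta> \<in> ball \<theta> \<epsilon>" for \<eta> x
      using w(3)[OF that, of x] family_pos[of x \<eta>] by (simp add: abs_mult mult_ac)
  qed measurable
qed

lemma expectation_continuous:
  assumes "f \<in> borel_measurable borel" and "\<And>x. \<bar>f x\<bar> \<le> C * (1 + \<bar>h x\<bar>)"
  shows "continuous_on UNIV (\<lambda>\<theta>. \<integral>x. f x * \<rho> x \<theta> \<partial>lborel)"
  using expectation_GDERIV[OF assms] unfolding gderiv_def
  by (intro continuous_at_imp_continuous_on ballI) (blast intro: has_derivative_continuous)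

lemma family_bounds_on_compact:
  assumes "compact K" "compact T"
  obtains C where "0 < C" "\<And>x \<theta>. x \<in> K \<Longrightarrow> \<theta> \<in> T \<Longrightarrow> \<rho> x \<theta> \<le> C"
    "\<And>x \<theta>. x \<in> K \<Longrightarrow> \<theta> \<in> T \<Longrightarrow> 1 / C \<le> \<rho> x \<theta>"
proof -
  have "compact (K \<times> T)" using assms by (rule compact_Times)
  moreover have "continuous_on (K \<times> T) (\<lambda>(x, \<theta>). \<rho> x \<theta>)"
    using family_continuous continuous_on_subset by blast
  moreover have "continuous_on (K \<times> T) (\<lambda>z. inverse (case z of (x, \<theta>) \<Rightarrow> \<rho> x \<theta>))"
    using \<open>continuous_on (K \<times> T) (\<lambda>(x, \<theta>). \<rho> x \<theta>)\<close> family_pos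
    by (intro continuous_on_inverse) (auto simp: less_imp_neq[symmetric])
  ultimately have "bounded ((\<lambda>(x, \<theta>). \<rho> x \<theta>) ` (K \<times> T))"
      "bounded ((\<lambda>z. inverse (case z of (x, \<theta>) \<Rightarrow> \<rho> x \<theta>)) ` (K \<times> T))"
    by (auto intro!: compact_imp_bounded compact_continuous_image)
  then obtain B1 B2 where B: "\<And>x \<theta>. x \<in> K \<Longrightarrow> \<theta> \<in> T \<Longrightarrow> \<bar>\<rho> x \<theta>\<bar> \<le> B1"
      "\<And>x \<theta>. x \<in> K \<Longrightarrow> \<theta> \<in> T \<Longrightarrow> \<bar>inverse (\<rho> x \<theta>)\<bar> \<le> B2"
    unfolding bounded_iff by fastforce
  define C where "C = max 1 (max B1 B2)"
  have C: "0 < C" "B1 \<le> C" "B2 \<le> C" by (auto simp: C_def)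
  show ?thesis
  proof (rule that[OF C(1)])
    fix x \<theta> assume x: "x \<in> K" "\<theta> \<in> T"
    show "\<rho> x \<theta> \<le> C" using B(1)[OF x] C by linarith
    have "inverse (\<rho> x \<theta>) \<le> C" using B(2)[OF x] C by linarith
    then show "1 / C \<le> \<rho> x \<theta>" using family_pos[of x \<theta>] C(1) by (simp add: field_simps)
  qed
qed

text \<open>On a compact set \<open>\<rho>\<close> is bounded and bounded away from \<open>0\<close>. Hence integrability of a compactly
  supported function against one member of the family passes to every other member.\<close>

lemma compact_support_integrable_iff:
  assumes [measurable]: "q \<in> borel_measurable borel" and K: "compact K" "\<And>x. x \<notin> K \<Longrightarrow> q x = 0"
  shows "integrable lborel (\<lambda>x. q x * \<rho> x \<theta>) \<longleftrightarrow> integrable lborel q"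
proof -
  obtain C where C: "0 < C" "\<And>x. x \<in> K \<Longrightarrow> \<rho> x \<theta> \<le> C" "\<And>x. x \<in> K \<Longrightarrow> 1 / C \<le> \<rho> x \<theta>"
    using family_bounds_on_compact[OF K(1) compact_sing[of \<theta>]] by (metis insertI1)
  show ?thesis
  proof
    assume "integrable lborel (\<lambda>x. q x * \<rho> x \<theta>)"
    then have i: "integrable lborel (\<lambda>x. C * (q x * \<rho> x \<theta>))" by simp
    show "integrable lborel q"
    proof (rule Bochner_Integration.integrable_bound[OF i])
      have "\<bar>q x\<bar> \<le> \<bar>C * (q x * \<rho> x \<theta>)\<bar>" for x
      proof (cases "x \<in> K")
        case True
        have "1 \<le> C * \<rho> x \<theta>" using C(1) C(3)[OF True] by (simp add: field_simps)
        then have "\<bar>q x\<bar> * 1 \<le> \<bar>q x\<bar> * (C * \<rho> x \<theta>)" by (intro mult_left_mono) auto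
        then show ?thesis using C(1) family_pos[of x \<theta>] by (simp add: abs_mult mult_ac)
      qed (simp add: K)
      then show "AE x in lborel. norm (q x) \<le> norm (C * (q x * \<rho> x \<theta>))" by simp
    qed simp
  next
    assume "integrable lborel q"
    then have i: "integrable lborel (\<lambda>x. C * q x)" by simp
    show "integrable lborel (\<lambda>x. q x * \<rho> x \<theta>)"
    proof (rule Bochner_Integration.integrable_bound[OF i])
      have "\<bar>q x * \<rho> x \<theta>\<bar> \<le> \<bar>C * q x\<bar>" for x
      proof (cases "x \<in> K")
        case True
        have "\<bar>q x\<bar> * \<rho> x \<theta> \<le> \<bar>q x\<bar> * C" using C(2)[OF True] by (intro mult_left_mono) auto
        then show ?thesis using C(1) family_pos[of x \<theta>] by (simp add: abs_mult mult_ac)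
      qed (simp add: K)
      then show "AE x in lborel. norm (q x * \<rho> x \<theta>) \<le> norm (C * q x)" by simp
    qed simp
  qed
qed

lemma compact_support_expectation_continuous:
  assumes q: "integrable lborel q" and K: "compact K" "\<And>x. x \<notin> K \<Longrightarrow> q x = 0"
  shows "continuous_on UNIV (\<lambda>\<theta>. \<integral>x. q x * \<rho> x \<theta> \<partial>lborel)"
proof (intro continuous_at_imp_continuous_on ballI)
  fix \<theta> :: "real^'m"
  obtain C where C: "0 < C" "\<And>x \<eta>. x \<in> K \<Longrightarrow> \<eta> \<in> cball \<theta> 1 \<Longrightarrow> \<rho> x \<eta> \<le> C"
    using family_bounds_on_compact[OF K(1) compact_cball[of \<theta> 1]] by metis
  have [measurable]: "q \<in> borel_measurable borel"
    using borel_measurable_integrable[OF q] by simp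
  show "isCont (\<lambda>\<theta>. \<integral>x. q x * \<rho> x \<theta> \<partial>lborel) \<theta>"
    unfolding isCont_def
  proof (rule tendsto_integral_dominated[of _ _ _ _ 1])
    show "((\<lambda>\<eta>. q x * \<rho> x \<eta>) \<longlongrightarrow> q x * \<rho> x \<theta>) (at \<theta>)" for x
      using density_continuous[of \<theta> x] by (intro tendsto_intros) (auto simp: isCont_def)
    show "integrable lborel (\<lambda>x. C * \<bar>q x\<bar>)" using q by simp
    show "norm (q x * \<rho> x \<eta>) \<le> C * \<bar>q x\<bar>" if "\<eta> \<in> ball \<theta> 1" for \<eta> x
    proof (cases "x \<in> K")
      case True
      have "\<bar>q x\<bar> * \<rho> x \<eta> \<le> \<bar>q x\<bar> * C"
        using C(2)[OF True, of \<eta>] that by (intro mult_left_mono) auto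
      then show ?thesis using family_pos[of x \<eta>] by (simp add: abs_mult mult_ac)
    qed (simp add: K)
  qed auto
qed

text \<open>Differentiate the constant total mass of \<open>\<rho>\<close> in the parameter.\<close>

lemma integral_score_eq_0: "(\<integral>x. \<rho> x \<theta> *\<^sub>R score \<rho> x \<theta> \<partial>lborel) = 0"
proof -
  let ?D = "\<integral>x. \<rho> x \<theta> *\<^sub>R score \<rho> x \<theta> \<partial>lborel"
  have "((\<lambda>\<eta>. \<integral>x. \<rho> x \<eta> \<partial>lborel) has_derivative (\<lambda>v. v \<bullet> ?D)) (at \<theta>)"
    using expectation_GDERIV[of "\<lambda>_. 1" 1 \<theta>] by (simp add: gderiv_def)
  then have "((\<lambda>_. 1) has_derivative (\<lambda>v. v \<bullet> ?D)) (at \<theta>)"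
    by (simp add: family_integrable)
  then have "(\<lambda>v. v \<bullet> ?D) = (\<lambda>v. 0)"
    by (rule has_derivative_unique) simp
  then have "?D \<bullet> ?D = 0" by metis
  then show ?thesis by simp
qed

context
  assumes cost_measurable [measurable]: "h \<in> borel_measurable borel"
begin

lemma cost_gradient_eq: "cost_gradient h \<rho> \<theta> = (\<integral>x. (h x * \<rho> x \<theta>) *\<^sub>R score \<rho> x \<theta> \<partial>lborel)"
proof -
  have i: "integrable lborel (\<lambda>x. (h x * \<rho> x \<theta>) *\<^sub>R score \<rho> x \<theta>)"
    by (rule family_integrable_score[of h 1]) auto
  have "cost_gradient h \<rho> \<theta> $ k = (\<integral>x. (h x * \<rho> x \<theta>) *\<^sub>R score \<rho> x \<theta> \<partial>lborel) $ k" for k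
    using integral_inner_left[OF i, of "axis k 1"]
    by (simp add: cost_gradient_def inner_axis mult_ac)
  then show ?thesis by (simp add: vec_eq_iff)
qed

lemma expected_cost_GDERIV: "GDERIV (expected_cost h \<rho>) \<theta> :> cost_gradient h \<rho> \<theta>"
  unfolding expected_cost_def[abs_def] cost_gradient_eq
  by (rule expectation_GDERIV[of h 1]) auto

text \<open>Multiply the pointwise identity by a component of \<open>score * \<rho>\<close> and integrate: the left-hand side becomes
  a row of the Fisher matrix applied to \<open>v\<close>, and the constant \<open>c\<close> drops out because the score has mean zero.\<close>

lemma natural_gradient_identity:
  assumes ae: "AE x in lborel. score \<rho> x \<theta> \<bullet> v + \<beta> * (h x - c) = 0"
  shows "fisher_matrix \<rho> \<theta> *v v = - \<beta> *\<^sub>R cost_gradient h \<rho> \<theta>"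
proof -
  have i_h: "integrable lborel (\<lambda>x. (h x * \<rho> x \<theta>) *\<^sub>R score \<rho> x \<theta>)"
    by (rule family_integrable_score[of h 1]) auto
  have i_1: "integrable lborel (\<lambda>x. \<rho> x \<theta> *\<^sub>R score \<rho> x \<theta>)"
    using family_integrable_score[of "\<lambda>_. 1" 1 \<theta>] by auto
  have i_f: "integrable lborel (\<lambda>x. score \<rho> x \<theta> $ i * score \<rho> x \<theta> $ j * \<rho> x \<theta>)" for i j
    using family by (simp add: regular_family_def)
  have "(fisher_matrix \<rho> \<theta> *v v) $ i = (- \<beta> *\<^sub>R cost_gradient h \<rho> \<theta>) $ i" for i
  proof -
    have "(fisher_matrix \<rho> \<theta> *v v) $ i = (\<Sum>j\<in>UNIV. (\<integral>x. score \<rho> x \<theta> $ i * score \<rho> x \<theta> $ j * \<rho> x \<theta> * v $ j \<partial>lborel))"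
      by (simp add: matrix_vector_mult_def fisher_matrix_def)
    also have "\<dots> = (\<integral>x. (\<Sum>j\<in>UNIV. score \<rho> x \<theta> $ i * score \<rho> x \<theta> $ j * \<rho> x \<theta> * v $ j) \<partial>lborel)"
      using i_f by (intro Bochner_Integration.integral_sum[symmetric] integrable_mult_left)
    also have "\<dots> = (\<integral>x. ((- \<beta>) *\<^sub>R ((h x * \<rho> x \<theta>) *\<^sub>R score \<rho> x \<theta>) + (\<beta> * c) *\<^sub>R (\<rho> x \<theta> *\<^sub>R score \<rho> x \<theta>)) \<bullet> axis i 1 \<partial>lborel)"
    proof (rule integral_cong_AE)
      show "AE x in lborel. (\<Sum>j\<in>UNIV. score \<rho> x \<theta> $ i * score \<rho> x \<theta> $ j * \<rho> x \<theta> * v $ j) =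
        ((- \<beta>) *\<^sub>R ((h x * \<rho> x \<theta>) *\<^sub>R score \<rho> x \<theta>) + (\<beta> * c) *\<^sub>R (\<rho> x \<theta> *\<^sub>R score \<rho> x \<theta>)) \<bullet> axis i 1"
        using ae
      proof eventually_elim
        case (elim x)
        have "(\<Sum>j\<in>UNIV. score \<rho> x \<theta> $ i * score \<rho> x \<theta> $ j * \<rho> x \<theta> * v $ j) =
            score \<rho> x \<theta> $ i * \<rho> x \<theta> * (score \<rho> x \<theta> \<bullet> v)"
          by (simp add: inner_vec_def sum_distrib_left mult_ac)
        also have "score \<rho> x \<theta> \<bullet> v = - \<beta> * (h x - c)" using elim by simp
        finally show ?case by (simp add: inner_axis algebra_simps)
      qed
    qed (use borel_measurable_integrable[OF i_f] in \<open>auto intro!: borel_measurable_sum borel_measurable_times\<close>)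
    also have "\<dots> = (\<integral>x. (- \<beta>) *\<^sub>R ((h x * \<rho> x \<theta>) *\<^sub>R score \<rho> x \<theta>) + (\<beta> * c) *\<^sub>R (\<rho> x \<theta> *\<^sub>R score \<rho> x \<theta>) \<partial>lborel) \<bullet> axis i 1"
      using i_h i_1 by (intro integral_inner_left Bochner_Integration.integrable_add integrable_scaleR_right)
    also have "\<dots> = (- \<beta> *\<^sub>R cost_gradient h \<rho> \<theta>) $ i"
    proof -
      have "(\<integral>x. (- \<beta>) *\<^sub>R ((h x * \<rho> x \<theta>) *\<^sub>R score \<rho> x \<theta>) + (\<beta> * c) *\<^sub>R (\<rho> x \<theta> *\<^sub>R score \<rho> x \<theta>) \<partial>lborel) =
        (- \<beta>) *\<^sub>R (\<integral>x. (h x * \<rho> x \<theta>) *\<^sub>R score \<rho> x \<theta> \<partial>lborel) + (\<beta> * c) *\<^sub>R (\<integral>x. \<rho> x \<theta> *\<^sub>R score \<rho> x \<theta> \<partial>lborel)"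
        using i_h i_1 by (subst Bochner_Integration.integral_add) (auto simp only: integrable_scaleR_right integral_scaleR_right)
      then show ?thesis by (simp add: cost_gradient_eq integral_score_eq_0 inner_axis)
    qed
    finally show ?thesis .
  qed
  then show ?thesis by (simp add: vec_eq_iff)
qed

end

end

text \<open>Outside this context the left-hand side of \<open>family_measurable\<close> would match every function.\<close>

declare family_measurable [measurable del] score_measurable [measurable del]

section \<open>Expected increments of a differentiable process\<close>

text \<open>The Henstock-Kurzweil form of the fundamental theorem of calculus recovers the increment of a path from
  a derivative that merely exists everywhere. Taking
  expectations and exchanging them with the time integral is Fubini's theorem, which uses the uniform
  bound \<open>C\<close> on the expected speed. Joint measurability in time and chance comes from the continuity of the
  paths, and for the derivative from its being a limit of difference quotients.\<close>

lemma expectation_increment_has_integral: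
  fixes \<xi> \<eta> :: "real \<Rightarrow> 'w \<Rightarrow> real"
  assumes "prob_space M" and ab: "a < b"
    and meas: "\<And>t. t \<in> {a..b} \<Longrightarrow> \<xi> t \<in> borel_measurable M"
    and int: "integrable M (\<xi> a)" "integrable M (\<xi> b)"
    and deriv: "AE \<omega> in M. \<forall>t\<in>{a..b}.
      ((\<lambda>s. \<xi> s \<omega>) has_real_derivative \<eta> t \<omega>) (at t within {a..b})"
    and int_\<eta>: "\<And>t. t \<in> {a..b} \<Longrightarrow> integrable M (\<eta> t)"
    and bound: "\<And>t. t \<in> {a..b} \<Longrightarrow> (\<integral>\<omega>. \<bar>\<eta> t \<omega>\<bar> \<partial>M) \<le> C"
  shows "((\<lambda>t. \<integral>\<omega>. \<eta> t \<omega> \<partial>M) has_integral ((\<integral>\<omega>. \<xi> b \<omega> \<partial>M) - (\<integral>\<omega>. \<xi> a \<omega> \<partial>M))) {a..b}"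
proof -
  interpret prob_space M by fact
  interpret P: pair_sigma_finite "lborel :: real measure" M ..
  obtain N where N: "N \<in> null_sets M" and "{\<omega> \<in> space M. \<not> (\<forall>t\<in>{a..b}.
      ((\<lambda>s. \<xi> s \<omega>) has_real_derivative \<eta> t \<omega>) (at t within {a..b}))} \<subseteq> N"
    using deriv unfolding eventually_ae_filter by blast
  then have der: "((\<lambda>s. \<xi> s \<omega>) has_real_derivative \<eta> t \<omega>) (at t within {a..b})"
    if "\<omega> \<in> space M" "\<omega> \<notin> N" "t \<in> {a..b}" for \<omega> t
    using that by blast
  have [measurable]: "N \<in> sets M" using N by auto
  (* Paths are frozen outside the interval and set to 0 on the exceptional null set,
     so that every path is continuous on the whole line. *)
  define clamp where "clamp t = max a (min b t)" for t :: real
  have clamp: "clamp t \<in> {a..b}" for t using ab by (auto simp: clamp_def)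
  have clamp_id: "clamp t = t" if "t \<in> {a..b}" for t using that by (auto simp: clamp_def)
  define \<zeta> where "\<zeta> t \<omega> = (if \<omega> \<in> N then 0 else \<xi> (clamp t) \<omega>)" for t \<omega>
  have \<zeta>_meas: "\<zeta> t \<in> borel_measurable M" for t
    using meas[OF clamp[of t]] unfolding \<zeta>_def[abs_def] by measurable
  have \<zeta>_cont: "continuous_on UNIV (\<lambda>t. \<zeta> t \<omega>)" if "\<omega> \<in> space M" for \<omega>
  proof (cases "\<omega> \<in> N")
    case False
    have "continuous_on {a..b} (\<lambda>s. \<xi> s \<omega>)"
      using DERIV_continuous_on[OF der[OF that False]] by blast
    moreover have "continuous_on UNIV clamp"
      unfolding clamp_def[abs_def] by (intro continuous_intros)
    ultimately have "continuous_on UNIV (\<lambda>t. \<xi> (clamp t) \<omega>)"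
      using clamp by (auto intro: continuous_on_compose2)
    then show ?thesis using False by (simp add: \<zeta>_def)
  qed (simp add: \<zeta>_def)
  (* Approximate t from below by multiples of 1 / (n + 1). *)
  have \<zeta>_joint: "(\<lambda>(t, \<omega>). \<zeta> t \<omega>) \<in> borel_measurable (lborel \<Otimes>\<^sub>M M)"
  proof (rule borel_measurable_LIMSEQ_real)
    show "(\<lambda>(t, \<omega>). \<zeta> (of_int \<lfloor>real (Suc n) * t\<rfloor> / real (Suc n)) \<omega>) \<in> borel_measurable (lborel \<Otimes>\<^sub>M M)" for n
    proof -
      have "(\<lambda>z. \<zeta> (of_int \<lfloor>real (Suc n) * fst z\<rfloor> / real (Suc n)) (snd z)) \<in> borel_measurable (lborel \<Otimes>\<^sub>M M)"
      proof (rule measurable_compose_countable[of "\<lambda>i z. \<zeta> (of_int i / real (Suc n)) (snd z)"])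
        show "(\<lambda>z. \<zeta> (of_int i / real (Suc n)) (snd z)) \<in> borel_measurable (lborel \<Otimes>\<^sub>M M)" for i :: int
          by (rule measurable_compose[OF measurable_snd \<zeta>_meas])
        show "(\<lambda>z. \<lfloor>real (Suc n) * fst z\<rfloor>) \<in> lborel \<Otimes>\<^sub>M M \<rightarrow>\<^sub>M count_space UNIV"
          by measurable
      qed
      then show ?thesis by (simp add: case_prod_beta')
    qed
    fix z assume "z \<in> space ((lborel :: real measure) \<Otimes>\<^sub>M M)"
    then obtain t \<omega> where z: "z = (t, \<omega>)" "\<omega> \<in> space M"
      by (auto simp: space_pair_measure)
    have "(\<lambda>n. of_int \<lfloor>real (Suc n) * t\<rfloor> / real (Suc n)) \<longlonglongrightarrow> t"
    proof (rule real_tendsto_sandwich)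
      show "(\<lambda>n. t - inverse (real (Suc n))) \<longlonglongrightarrow> t"
        using tendsto_diff[OF tendsto_const LIMSEQ_inverse_real_of_nat, of t] by simp
      show "(\<lambda>n. t) \<longlonglongrightarrow> t" by simp
      show "\<forall>\<^sub>F n in sequentially. t - inverse (real (Suc n)) \<le> of_int \<lfloor>real (Suc n) * t\<rfloor> / real (Suc n)"
      proof (intro always_eventually allI)
        fix n
        have "real (Suc n) * t - 1 \<le> of_int \<lfloor>real (Suc n) * t\<rfloor>" by linarith
        then have "(real (Suc n) * t - 1) / real (Suc n) \<le> of_int \<lfloor>real (Suc n) * t\<rfloor> / real (Suc n)"
          by (rule divide_right_mono) simp
        then show "t - inverse (real (Suc n)) \<le> of_int \<lfloor>real (Suc n) * t\<rfloor> / real (Suc n)"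
          by (simp add: diff_divide_distrib inverse_eq_divide)
      qed
      show "\<forall>\<^sub>F n in sequentially. of_int \<lfloor>real (Suc n) * t\<rfloor> / real (Suc n) \<le> t"
      proof (intro always_eventually allI)
        fix n
        have "of_int \<lfloor>real (Suc n) * t\<rfloor> / real (Suc n) \<le> (real (Suc n) * t) / real (Suc n)"
          by (rule divide_right_mono) (linarith, simp)
        then show "of_int \<lfloor>real (Suc n) * t\<rfloor> / real (Suc n) \<le> t" by simp
      qed
    qed
    then have "(\<lambda>n. \<zeta> (of_int \<lfloor>real (Suc n) * t\<rfloor> / real (Suc n)) \<omega>) \<longlonglongrightarrow> \<zeta> t \<omega>"
      using continuous_on_tendsto_compose[OF \<zeta>_cont[OF z(2)]] by simp
    then show "(\<lambda>n. case z of (t, \<omega>) \<Rightarrow> \<zeta> (of_int \<lfloor>real (Suc n) * t\<rfloor> / real (Suc n)) \<omega>)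
        \<longlonglongrightarrow> (case z of (t, \<omega>) \<Rightarrow> \<zeta> t \<omega>)"
      by (simp add: z)
  qed
  (* The derivative is restricted to the open interval, where difference quotients
     converge from both sides; the end points have measure zero. *)
  define D where "D t \<omega> = (if t \<in> {a<..<b} \<and> \<omega> \<notin> N then \<eta> t \<omega> else 0)" for t \<omega>
  have D_joint: "(\<lambda>(t, \<omega>). D t \<omega>) \<in> borel_measurable (lborel \<Otimes>\<^sub>M M)"
  proof (rule borel_measurable_LIMSEQ_real)
    let ?s = "\<lambda>n. inverse (real (Suc n))"
    let ?q = "\<lambda>n (t, \<omega>). indicator {a<..<b} t * ((\<zeta> (t + ?s n) \<omega> - \<zeta> t \<omega>) / ?s n)"
    have "(\<lambda>z. \<zeta> (fst z + ?s n) (snd z)) \<in> borel_measurable (lborel \<Otimes>\<^sub>M M)" for n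
    proof -
      have "(\<lambda>z. (fst z + ?s n, snd z)) \<in> lborel \<Otimes>\<^sub>M M \<rightarrow>\<^sub>M lborel \<Otimes>\<^sub>M M"
        by measurable
      from measurable_compose[OF this \<zeta>_joint] show ?thesis by simp
    qed
    moreover have "(\<lambda>z. \<zeta> (fst z) (snd z)) \<in> borel_measurable (lborel \<Otimes>\<^sub>M M)"
      using \<zeta>_joint by (simp add: case_prod_beta')
    ultimately show "?q n \<in> borel_measurable (lborel \<Otimes>\<^sub>M M)" for n
      unfolding case_prod_beta' by measurable
    fix z assume "z \<in> space ((lborel :: real measure) \<Otimes>\<^sub>M M)"
    then obtain t \<omega> where z: "z = (t, \<omega>)" "\<omega> \<in> space M"
      by (auto simp: space_pair_measure)
    show "(\<lambda>n. ?q n z) \<longlonglongrightarrow> (case z of (t, \<omega>) \<Rightarrow> D t \<omega>)"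
    proof (cases "t \<in> {a<..<b} \<and> \<omega> \<notin> N")
      case True
      have "at t within {a..b} = at t"
        using True by (intro at_within_interior) (simp add: interior_atLeastAtMost_real)
      then have "((\<lambda>s. \<xi> s \<omega>) has_real_derivative \<eta> t \<omega>) (at t)"
        using der[OF z(2), of t] True by simp
      then have "((\<lambda>s. \<zeta> s \<omega>) has_real_derivative \<eta> t \<omega>) (at t)"
        by (rule DERIV_cong_ev[THEN iffD1, rotated -1])
           (use True in \<open>auto simp: \<zeta>_def clamp_id intro!: eventually_mono[OF eventually_nhds_in_open[of "{a<..<b}"]]\<close>)
      then have "((\<lambda>r. (\<zeta> (t + r) \<omega> - \<zeta> t \<omega>) / r) \<longlongrightarrow> \<eta> t \<omega>) (at 0)"
        by (simp add: DERIV_def)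
      moreover have "filterlim ?s (at 0) sequentially"
        using LIMSEQ_inverse_real_of_nat by (simp add: filterlim_at)
      ultimately have "(\<lambda>n. (\<zeta> (t + ?s n) \<omega> - \<zeta> t \<omega>) / ?s n) \<longlonglongrightarrow> \<eta> t \<omega>"
        by (rule filterlim_compose)
      then show ?thesis using True by (simp add: z D_def)
    next
      case False
      then have q: "?q n z = 0" for n by (auto simp: z \<zeta>_def indicator_def)
      have D: "(case z of (t, \<omega>) \<Rightarrow> D t \<omega>) = 0" using False by (auto simp: z D_def)
      show ?thesis
        unfolding D by (intro tendsto_eventually always_eventually allI q)
    qed
  qed
  have D_\<eta>: "AE \<omega> in M. D t \<omega> = \<eta> t \<omega>" if "t \<in> {a<..<b}" for t
    using AE_not_in[OF N] that by (auto simp: D_def)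
  have D_int: "integrable M (D t)" and D_abs: "(\<integral>\<omega>. \<bar>D t \<omega>\<bar> \<partial>M) \<le> \<bar>C\<bar> * indicator {a..b} t"
    and D_integral: "t \<in> {a<..<b} \<Longrightarrow> (\<integral>\<omega>. D t \<omega> \<partial>M) = (\<integral>\<omega>. \<eta> t \<omega> \<partial>M)" for t
  proof -
    have D_meas [measurable]: "D t \<in> borel_measurable M"
      using measurable_Pair2[OF D_joint, of t] by simp
    show "integrable M (D t)"
    proof (cases "t \<in> {a<..<b}")
      case True
      have "AE \<omega> in M. \<eta> t \<omega> = D t \<omega>" using D_\<eta>[OF True] by eventually_elim simp
      then show ?thesis
        using True by (intro integrable_cong_AE_imp[OF int_\<eta>[of t] D_meas]) auto
    next
      case False
      then have "D t = (\<lambda>_. 0)" by (auto simp: D_def fun_eq_iff)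
      then show ?thesis by simp
    qed
    show "(\<integral>\<omega>. D t \<omega> \<partial>M) = (\<integral>\<omega>. \<eta> t \<omega> \<partial>M)" if "t \<in> {a<..<b}"
      using D_\<eta>[OF that] that borel_measurable_integrable[OF int_\<eta>[of t]] by (intro integral_cong_AE) auto
    show "(\<integral>\<omega>. \<bar>D t \<omega>\<bar> \<partial>M) \<le> \<bar>C\<bar> * indicator {a..b} t"
    proof (cases "t \<in> {a<..<b}")
      case True
      have "(\<integral>\<omega>. \<bar>D t \<omega>\<bar> \<partial>M) = (\<integral>\<omega>. \<bar>\<eta> t \<omega>\<bar> \<partial>M)"
        using D_\<eta>[OF True] True borel_measurable_integrable[OF int_\<eta>[of t]] by (intro integral_cong_AE) auto
      also have "\<dots> \<le> \<bar>C\<bar>" using bound[of t] True by simp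
      finally show ?thesis using True by simp
    qed (auto simp: D_def)
  qed
  have D_pair: "integrable (lborel \<Otimes>\<^sub>M M) (\<lambda>(t, \<omega>). D t \<omega>)"
  proof (rule P.Fubini_integrable[OF D_joint])
    have "integrable lborel (\<lambda>t. \<integral>\<omega>. \<bar>D t \<omega>\<bar> \<partial>M)"
    proof (rule Bochner_Integration.integrable_bound)
      show "integrable lborel (\<lambda>t. \<bar>C\<bar> * indicator {a..b} t)"
        by (intro integrable_mult_right integrable_real_indicator) (auto simp: emeasure_lborel_Icc_eq)
      have "(\<lambda>(t, \<omega>). \<bar>D t \<omega>\<bar>) \<in> borel_measurable (lborel \<Otimes>\<^sub>M M)"
        using borel_measurable_abs[OF D_joint] by (simp add: case_prod_beta')
      then show "(\<lambda>t. \<integral>\<omega>. \<bar>D t \<omega>\<bar> \<partial>M) \<in> borel_measurable lborel"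
        by (rule borel_measurable_lebesgue_integral)
      show "AE t in lborel. norm (\<integral>\<omega>. \<bar>D t \<omega>\<bar> \<partial>M) \<le> norm (\<bar>C\<bar> * indicator {a..b} t)"
        using D_abs by (intro AE_I2) (simp add: abs_of_nonneg Bochner_Integration.integral_nonneg)
    qed
    then show "integrable lborel (\<lambda>t. \<integral>\<omega>. norm (case (t, \<omega>) of (t, \<omega>) \<Rightarrow> D t \<omega>) \<partial>M)" by simp
  qed (use D_int in simp)
  have pathwise: "(\<integral>t. D t \<omega> \<partial>lborel) = \<xi> b \<omega> - \<xi> a \<omega>"
    if "\<omega> \<in> space M" "\<omega> \<notin> N" and i: "integrable lborel (\<lambda>t. D t \<omega>)" for \<omega>
  proof -
    have "((\<lambda>t. \<eta> t \<omega>) has_integral (\<xi> b \<omega> - \<xi> a \<omega>)) {a..b}"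
      using der[OF that(1,2)] ab
      by (intro fundamental_theorem_of_calculus) (auto simp: has_real_derivative_iff_has_vector_derivative)
    then have "((\<lambda>t. \<eta> t \<omega>) has_integral (\<xi> b \<omega> - \<xi> a \<omega>)) {a<..<b}"
      by (simp add: has_integral_Icc_iff_Ioo)
    then have "((\<lambda>t. if t \<in> {a<..<b} then \<eta> t \<omega> else 0) has_integral (\<xi> b \<omega> - \<xi> a \<omega>)) UNIV"
      by (simp only: has_integral_restrict_UNIV)
    moreover have "(\<lambda>t. if t \<in> {a<..<b} then \<eta> t \<omega> else 0) = (\<lambda>t. D t \<omega>)"
      using that by (auto simp: D_def)
    ultimately show ?thesis
      using has_integral_integral_lborel[OF i] has_integral_unique by metis
  qed
  have "AE \<omega> in M. (\<integral>t. D t \<omega> \<partial>lborel) = \<xi> b \<omega> - \<xi> a \<omega>"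
    using P.AE_integrable_snd[OF D_pair] AE_not_in[OF N] AE_space
    by eventually_elim (rule pathwise)
  then have "(\<integral>\<omega>. (\<integral>t. D t \<omega> \<partial>lborel) \<partial>M) = (\<integral>\<omega>. \<xi> b \<omega> - \<xi> a \<omega> \<partial>M)"
    using borel_measurable_integrable[OF P.integrable_snd[OF D_pair]] int
    by (intro integral_cong_AE) auto
  also have "(\<integral>\<omega>. (\<integral>t. D t \<omega> \<partial>lborel) \<partial>M) = (\<integral>t. (\<integral>\<omega>. D t \<omega> \<partial>M) \<partial>lborel)"
    by (rule P.Fubini_integral[OF D_pair])
  finally have eq: "(\<integral>t. (\<integral>\<omega>. D t \<omega> \<partial>M) \<partial>lborel) = (\<integral>\<omega>. \<xi> b \<omega> \<partial>M) - (\<integral>\<omega>. \<xi> a \<omega> \<partial>M)"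
    using int by simp
  have "((\<lambda>t. \<integral>\<omega>. D t \<omega> \<partial>M) has_integral ((\<integral>\<omega>. \<xi> b \<omega> \<partial>M) - (\<integral>\<omega>. \<xi> a \<omega> \<partial>M))) UNIV"
    using has_integral_integral_lborel[OF P.integrable_fst[OF D_pair]] by (simp add: eq)
  moreover have "(\<lambda>t. \<integral>\<omega>. D t \<omega> \<partial>M) = (\<lambda>t. if t \<in> {a<..<b} then \<integral>\<omega>. \<eta> t \<omega> \<partial>M else 0)"
  proof
    show "(\<integral>\<omega>. D t \<omega> \<partial>M) = (if t \<in> {a<..<b} then \<integral>\<omega>. \<eta> t \<omega> \<partial>M else 0)" for t
      using D_integral[of t] by (cases "t \<in> {a<..<b}") (auto simp: D_def)
  qed
  ultimately have "((\<lambda>t. \<integral>\<omega>. \<eta> t \<omega> \<partial>M) has_integral ((\<integral>\<omega>. \<xi> b \<omega> \<partial>M) - (\<integral>\<omega>. \<xi> a \<omega> \<partial>M))) {a<..<b}"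
    by (simp only: has_integral_restrict_UNIV)
  then show ?thesis by (simp add: has_integral_Icc_iff_Ioo)
qed

section \<open>The energy of the drift is bounded on some subinterval of every interval\<close>

text \<open>If the supremum of the family were unbounded on every subinterval, then the sets of times at which it
  exceeds \<open>n\<close> would be open and dense for every \<open>n\<close>, and by Baire's theorem some time would lie in all
  of them, although the supremum is finite there.\<close>

lemma pointwise_bounded_continuous_family:
  fixes J :: "'i \<Rightarrow> real \<Rightarrow> real"
  assumes ab: "a < b"
    and cont: "\<And>i. i \<in> I \<Longrightarrow> continuous_on {a..b} (J i)"
    and bd: "\<And>i t. i \<in> I \<Longrightarrow> t \<in> {a..b} \<Longrightarrow> J i t \<le> F t"
  obtains c d N where "a \<le> c" "c < d" "d \<le> b" "\<And>i t. i \<in> I \<Longrightarrow> t \<in> {c..d} \<Longrightarrow> J i t \<le> (N::real)"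
proof (rule ccontr)
  note witness = that
  assume contra: "\<not> thesis"
  have no: "\<exists>i\<in>I. \<exists>t\<in>{c..d}. N < J i t" if "a \<le> c" "c < d" "d \<le> b" for c d N
  proof (rule ccontr)
    assume "\<not> (\<exists>i\<in>I. \<exists>t\<in>{c..d}. N < J i t)"
    then have "J i t \<le> N" if "i \<in> I" "t \<in> {c..d}" for i t
      using that by (meson linorder_not_less)
    from witness[OF \<open>a \<le> c\<close> \<open>c < d\<close> \<open>d \<le> b\<close> this] contra show False by blast
  qed
  define T where "T n = (\<Union>i\<in>I. {t \<in> {a..b}. real n < J i t})" for n
  have "{a..b} \<subseteq> closure (\<Inter> (range T))"
  proof (rule Baire)
    show "closed {a..b}" by simp
    show "countable (range T)" by simp
    fix T' assume "T' \<in> range T"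
    then obtain n where T': "T' = T n" by blast
    have "openin (top_of_set {a..b}) {t \<in> {a..b}. real n < J i t}" if "i \<in> I" for i
      using continuous_openin_preimage_gen[OF cont[OF that], of "{real n<..}"]
      by (simp add: vimage_def Int_def)
    then have "openin (top_of_set {a..b}) T'"
      unfolding T' T_def by (intro openin_Union) auto
    moreover have "{a..b} \<subseteq> closure T'"
    proof
      fix t assume t: "t \<in> {a..b}"
      show "t \<in> closure T'"
        unfolding closure_approachable
      proof (intro allI impI)
        fix e :: real assume e: "0 < e"
        define c where "c = max a (t - e / 2)"
        define d where "d = min b (t + e / 2)"
        have cd: "a \<le> c" "c < d" "d \<le> b" using ab t e by (auto simp: c_def d_def)
        obtain i s where s: "i \<in> I" "s \<in> {c..d}" "real n < J i s" using no[OF cd] by blast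
        then have "s \<in> T'" using cd by (auto simp: T' T_def)
        moreover have "dist s t < e"
          using s(2) e by (auto simp: c_def d_def dist_real_def abs_if)
        ultimately show "\<exists>s\<in>T'. dist s t < e" by blast
      qed
    qed
    ultimately show "openin (top_of_set {a..b}) T' \<and> {a..b} \<subseteq> closure T'" by blast
  qed
  moreover have "\<Inter> (range T) = {}"
  proof (rule ccontr)
    assume "\<Inter> (range T) \<noteq> {}"
    then obtain t where t: "\<And>n. t \<in> T n" by auto
    obtain n where "F t \<le> real n" using real_arch_simple by blast
    with t[of n] bd show False by (force simp: T_def)
  qed
  ultimately show False using ab by auto
qed

lemma norm_add_squared_le: "(norm (x + y))\<^sup>2 \<le> 2 * (norm x)\<^sup>2 + 2 * (norm (y :: 'a::real_inner))\<^sup>2"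
proof -
  have "0 \<le> (norm (x - y))\<^sup>2" by simp
  then show ?thesis by (simp add: power2_norm_eq_inner inner_simps inner_commute)
qed

lemma abs_inner_le_squares: "\<bar>x \<bullet> (y :: 'a::real_inner)\<bar> \<le> (norm x)\<^sup>2 + (norm y)\<^sup>2"
proof -
  have "\<bar>x \<bullet> y\<bar> \<le> norm x * norm y" by (rule Cauchy_Schwarz_ineq2)
  moreover have "0 \<le> (norm x - norm y)\<^sup>2" "0 \<le> norm x * norm y" by simp_all
  ultimately show ?thesis by (simp add: power2_diff)
qed

lemma H1_measurable:
  assumes "H1 p u g" shows "u \<in> borel_measurable borel" "g \<in> borel_measurable borel"
  using assms locally_integrable_measurable unfolding H1_def weak_gradient_def by blast+

lemma integrable_inner_gradients:
  fixes p :: "'a::euclidean_space \<Rightarrow> real"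
  assumes "H1 p u g" "H1 p u' g'" and p: "p \<in> borel_measurable borel" "\<And>x. 0 \<le> p x"
  shows "integrable lborel (\<lambda>x. (g x \<bullet> g' x) * p x)"
proof (rule Bochner_Integration.integrable_bound)
  show "integrable lborel (\<lambda>x. (norm (g x))\<^sup>2 * p x + (norm (g' x))\<^sup>2 * p x)"
    using assms by (simp add: H1_def)
  show "(\<lambda>x. (g x \<bullet> g' x) * p x) \<in> borel_measurable lborel"
    using H1_measurable[OF assms(1)] H1_measurable[OF assms(2)] p by simp
  show "AE x in lborel. norm ((g x \<bullet> g' x) * p x) \<le> norm ((norm (g x))\<^sup>2 * p x + (norm (g' x))\<^sup>2 * p x)"
  proof (rule AE_I2)
    fix x
    have "\<bar>g x \<bullet> g' x\<bar> * p x \<le> ((norm (g x))\<^sup>2 + (norm (g' x))\<^sup>2) * p x"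
      using abs_inner_le_squares p(2) by (rule mult_right_mono)
    then show "norm ((g x \<bullet> g' x) * p x) \<le> norm ((norm (g x))\<^sup>2 * p x + (norm (g' x))\<^sup>2 * p x)"
      using p(2)[of x] by (simp add: abs_mult distrib_right)
  qed
qed

text \<open>Dirichlet's principle: the weak equation turns \<open>\<integral> (h - mean h p) * \<psi> * p\<close> into \<open>\<integral> (g \<bullet> g') * p\<close>, and the
  integral of \<open>(norm (g - g'))\<^sup>2 * p\<close> is nonnegative.\<close>

lemma dual_energy_le:
  fixes p :: "'a::euclidean_space \<Rightarrow> real"
  assumes sol: "weak_poisson_solution h p \<phi> g" and H: "H1 p \<psi> g'"
    and p: "p \<in> borel_measurable borel" "\<And>x. 0 \<le> p x"
  shows "2 * (\<integral>x. (h x - mean h p) * \<psi> x * p x \<partial>lborel) - (\<integral>x. (norm (g' x))\<^sup>2 * p x \<partial>lborel)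
    \<le> (\<integral>x. (norm (g x))\<^sup>2 * p x \<partial>lborel)"
proof -
  have \<phi>: "H1 p \<phi> g" using sol by (simp add: weak_poisson_solution_def)
  have i: "integrable lborel (\<lambda>x. (g x \<bullet> g' x) * p x)" "integrable lborel (\<lambda>x. (norm (g' x))\<^sup>2 * p x)"
      "integrable lborel (\<lambda>x. (norm (g x))\<^sup>2 * p x)"
    using integrable_inner_gradients[OF \<phi> H p] \<phi> H by (auto simp: H1_def)
  have "2 * (\<integral>x. (h x - mean h p) * \<psi> x * p x \<partial>lborel) - (\<integral>x. (norm (g' x))\<^sup>2 * p x \<partial>lborel)
      = 2 * (\<integral>x. (g x \<bullet> g' x) * p x \<partial>lborel) - (\<integral>x. (norm (g' x))\<^sup>2 * p x \<partial>lborel)"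
    using sol H by (auto simp: weak_poisson_solution_def)
  also have "\<dots> = (\<integral>x. 2 * ((g x \<bullet> g' x) * p x) - (norm (g' x))\<^sup>2 * p x \<partial>lborel)"
    using i by simp
  also have "\<dots> \<le> (\<integral>x. (norm (g x))\<^sup>2 * p x \<partial>lborel)"
  proof (rule integral_mono)
    fix x
    have "0 \<le> (norm (g x - g' x))\<^sup>2 * p x" using p(2) by simp
    also have "(norm (g x - g' x))\<^sup>2 = (norm (g x))\<^sup>2 - 2 * (g x \<bullet> g' x) + (norm (g' x))\<^sup>2"
      by (simp add: power2_norm_eq_inner inner_simps inner_commute)
    finally show "2 * ((g x \<bullet> g' x) * p x) - (norm (g' x))\<^sup>2 * p x \<le> (norm (g x))\<^sup>2 * p x"
      by (simp add: algebra_simps)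
  qed (use i in auto)
  finally show ?thesis .
qed

text \<open>The weak gradient of \<open>\<lambda>x. cutoff r x * u x\<close> when \<open>g\<close> is the weak gradient of \<open>u\<close>.\<close>

abbreviation cut_gradient :: "real \<Rightarrow> ('a::euclidean_space \<Rightarrow> real) \<Rightarrow> ('a \<Rightarrow> 'a) \<Rightarrow> 'a \<Rightarrow> 'a" where
  "cut_gradient r u g x \<equiv> cutoff r x *\<^sub>R g x + u x *\<^sub>R grad (cutoff r) x"

lemma norm_cut_gradient_squared_le:
  assumes "1 \<le> r"
  shows "(norm (cut_gradient r u g x))\<^sup>2 \<le> 2 * (norm (g x))\<^sup>2 + 2 * (4 * exp 1)\<^sup>2 * (u x)\<^sup>2"
proof -
  have "norm (cutoff r x *\<^sub>R g x) \<le> norm (g x)"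
    by (simp add: cutoff_nonneg cutoff_le_1 mult_left_le_one_le)
  then have a: "(norm (cutoff r x *\<^sub>R g x))\<^sup>2 \<le> (norm (g x))\<^sup>2"
    by (intro power_mono) auto
  have "4 * exp 1 / r \<le> 4 * exp 1" using assms by (simp add: divide_le_eq)
  then have "norm (grad (cutoff r) x) \<le> 4 * exp 1"
    using norm_grad_cutoff_le[of r x] assms by linarith
  then have "norm (u x *\<^sub>R grad (cutoff r) x) \<le> \<bar>u x\<bar> * (4 * exp 1)"
    by (simp add: mult_left_mono)
  then have "(norm (u x *\<^sub>R grad (cutoff r) x))\<^sup>2 \<le> (\<bar>u x\<bar> * (4 * exp 1))\<^sup>2"
    by (intro power_mono) auto
  then have "(norm (u x *\<^sub>R grad (cutoff r) x))\<^sup>2 \<le> (4 * exp 1)\<^sup>2 * (u x)\<^sup>2"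
    by (simp add: power_mult_distrib mult_ac)
  with a norm_add_squared_le[of "cutoff r x *\<^sub>R g x" "u x *\<^sub>R grad (cutoff r) x"]
  show ?thesis by linarith
qed

text \<open>The bound of \<open>dual_energy_le\<close> is attained in the limit along the cutoffs of the solution itself. So
  compactly supported competitors already determine the energy.\<close>

lemma cutoff_energy_tendsto:
  fixes p :: "'a::euclidean_space \<Rightarrow> real"
  assumes H: "H1 p u g" and p: "p \<in> borel_measurable borel" "\<And>x. 0 \<le> p x"
  shows "((\<lambda>r. \<integral>x. (2 * (g x \<bullet> cut_gradient r u g x) - (norm (cut_gradient r u g x))\<^sup>2) * p x \<partial>lborel)
    \<longlongrightarrow> (\<integral>x. (norm (g x))\<^sup>2 * p x \<partial>lborel)) at_top"
proof (rule integral_dominated_convergence_at_top)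
  let ?c = "(4 * exp 1 :: real)\<^sup>2"
  (* The constants come from 2 a^2 + 3 (2 a^2 + 2 c u^2), where a is the length of g
     and c the square of the bound on the gradient of the cutoffs. *)
  let ?w = "\<lambda>x. 8 * ((norm (g x))\<^sup>2 * p x) + 6 * ?c * ((u x)\<^sup>2 * p x)"
  note [measurable] = H1_measurable[OF H] p(1)
  show "integrable lborel ?w" using H by (simp add: H1_def)
  show "AE x in lborel. ((\<lambda>r. (2 * (g x \<bullet> cut_gradient r u g x) - (norm (cut_gradient r u g x))\<^sup>2) * p x)
      \<longlongrightarrow> (norm (g x))\<^sup>2 * p x) at_top"
  proof (rule AE_I2)
    fix x
    have "((\<lambda>r. cut_gradient r u g x) \<longlongrightarrow> 1 *\<^sub>R g x + u x *\<^sub>R 0) at_top"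
      by (intro tendsto_intros cutoff_tendsto grad_cutoff_tendsto)
    then have "((\<lambda>r. cut_gradient r u g x) \<longlongrightarrow> g x) at_top" by simp
    then have "((\<lambda>r. (2 * (g x \<bullet> cut_gradient r u g x) - (norm (cut_gradient r u g x))\<^sup>2) * p x)
        \<longlongrightarrow> (2 * (g x \<bullet> g x) - (norm (g x))\<^sup>2) * p x) at_top"
      by (intro tendsto_intros)
    then show "((\<lambda>r. (2 * (g x \<bullet> cut_gradient r u g x) - (norm (cut_gradient r u g x))\<^sup>2) * p x)
        \<longlongrightarrow> (norm (g x))\<^sup>2 * p x) at_top"
      by (simp add: power2_norm_eq_inner)
  qed
  show "\<forall>\<^sub>F r in at_top. AE x in lborel.
      norm ((2 * (g x \<bullet> cut_gradient r u g x) - (norm (cut_gradient r u g x))\<^sup>2) * p x) \<le> ?w x"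
    using eventually_ge_at_top[of 1]
  proof eventually_elim
    case (elim r)
    show ?case
    proof (rule AE_I2)
      fix x
      have "\<bar>2 * (g x \<bullet> cut_gradient r u g x) - (norm (cut_gradient r u g x))\<^sup>2\<bar>
          \<le> 2 * (norm (g x))\<^sup>2 + 3 * (norm (cut_gradient r u g x))\<^sup>2"
        using abs_inner_le_squares[of "g x" "cut_gradient r u g x"]
          zero_le_power2[of "norm (cut_gradient r u g x)"] by linarith
      also have "\<dots> \<le> 2 * (norm (g x))\<^sup>2 + 3 * (2 * (norm (g x))\<^sup>2 + 2 * ?c * (u x)\<^sup>2)"
        using norm_cut_gradient_squared_le[OF elim, where u=u and g=g and x=x] by (intro add_mono mult_left_mono) auto
      also have "\<dots> = 8 * (norm (g x))\<^sup>2 + 6 * ?c * (u x)\<^sup>2" by simp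
      finally have "\<bar>2 * (g x \<bullet> cut_gradient r u g x) - (norm (cut_gradient r u g x))\<^sup>2\<bar> * p x
          \<le> (8 * (norm (g x))\<^sup>2 + 6 * ?c * (u x)\<^sup>2) * p x"
        using p(2) by (rule mult_right_mono)
      then show "norm ((2 * (g x \<bullet> cut_gradient r u g x) - (norm (cut_gradient r u g x))\<^sup>2) * p x) \<le> ?w x"
        using p(2)[of x] unfolding real_norm_def abs_mult by (simp add: algebra_simps)
    qed
  qed
  show "(\<lambda>x. (norm (g x))\<^sup>2 * p x) \<in> borel_measurable lborel" by measurable
  show "(\<lambda>x. (2 * (g x \<bullet> cut_gradient r u g x) - (norm (cut_gradient r u g x))\<^sup>2) * p x)
      \<in> borel_measurable lborel" for r by measurable
qed

text \<open>This is what makes a cutoff of the solution at one time an admissible competitor at all other times.\<close>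

lemma H1_cutoff:
  fixes h :: "'a::euclidean_space \<Rightarrow> real" and \<rho> :: "'a \<Rightarrow> real^'m \<Rightarrow> real"
  assumes family: "regular_family h \<rho>" and H: "H1 (\<lambda>x. \<rho> x \<theta>0) u g" and r: "1 \<le> r"
  shows "H1 (\<lambda>x. \<rho> x \<theta>1) (\<lambda>x. cutoff r x * u x) (cut_gradient r u g)"
proof -
  have "0 < r" using r by simp
  note tf = test_function_cutoff[OF this, where 'a='a]
  obtain K where K: "compact K" "\<And>x::'a. x \<notin> K \<Longrightarrow> cutoff r x = 0" "\<And>x::'a. x \<notin> K \<Longrightarrow> grad (cutoff r) x = 0"
    using test_function_support[OF tf] by blast
  note [measurable] = H1_measurable[OF H] family_measurable[OF family]
    borel_measurable_continuous_onI[OF test_function_continuous[OF tf]]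
    borel_measurable_continuous_onI[OF test_function_continuous_grad[OF tf]]
  note pos = less_imp_le[OF family_pos[OF family]]
  have i: "integrable lborel (\<lambda>x. (u x)\<^sup>2 * \<rho> x \<theta>0)" "integrable lborel (\<lambda>x. (norm (g x))\<^sup>2 * \<rho> x \<theta>0)"
    using H by (auto simp: H1_def)
  have transfer: "integrable lborel (\<lambda>x. q x * \<rho> x \<theta>1)"
    if "integrable lborel (\<lambda>x. q x * \<rho> x \<theta>0)" "q \<in> borel_measurable borel" "\<And>x. x \<notin> K \<Longrightarrow> q x = 0" for q
    using that compact_support_integrable_iff[OF family that(2) K(1) that(3)] by blast
  show ?thesis
    unfolding H1_def
  proof (intro conjI)
    show "weak_gradient (\<lambda>x. cutoff r x * u x) (cut_gradient r u g)"
      using H tf by (intro weak_gradient_mult_test_function) (auto simp: H1_def)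
    show "integrable lborel (\<lambda>x. (cutoff r x * u x)\<^sup>2 * \<rho> x \<theta>1)"
    proof (rule transfer)
      show "integrable lborel (\<lambda>x. (cutoff r x * u x)\<^sup>2 * \<rho> x \<theta>0)"
      proof (rule Bochner_Integration.integrable_bound[OF i(1)])
        have "(cutoff r x * u x)\<^sup>2 \<le> (u x)\<^sup>2" for x
          by (rule abs_le_square_iff[THEN iffD1])
             (simp add: abs_mult cutoff_nonneg cutoff_le_1 mult_left_le_one_le)
        then show "AE x in lborel. norm ((cutoff r x * u x)\<^sup>2 * \<rho> x \<theta>0) \<le> norm ((u x)\<^sup>2 * \<rho> x \<theta>0)"
          using pos by (intro AE_I2) (simp add: abs_mult mult_right_mono)
      qed simp
    qed (auto simp: K)
    show "integrable lborel (\<lambda>x. (norm (cut_gradient r u g x))\<^sup>2 * \<rho> x \<theta>1)"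
    proof (rule transfer)
      show "integrable lborel (\<lambda>x. (norm (cut_gradient r u g x))\<^sup>2 * \<rho> x \<theta>0)"
      proof (rule Bochner_Integration.integrable_bound)
        show "integrable lborel (\<lambda>x. 2 * ((norm (g x))\<^sup>2 * \<rho> x \<theta>0) + 2 * (4 * exp 1)\<^sup>2 * ((u x)\<^sup>2 * \<rho> x \<theta>0))"
          using i by simp
        show "AE x in lborel. norm ((norm (cut_gradient r u g x))\<^sup>2 * \<rho> x \<theta>0)
            \<le> norm (2 * ((norm (g x))\<^sup>2 * \<rho> x \<theta>0) + 2 * (4 * exp 1)\<^sup>2 * ((u x)\<^sup>2 * \<rho> x \<theta>0))"
        proof (rule AE_I2)
          fix x
          have "(norm (cut_gradient r u g x))\<^sup>2 * \<rho> x \<theta>0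
              \<le> (2 * (norm (g x))\<^sup>2 + 2 * (4 * exp 1)\<^sup>2 * (u x)\<^sup>2) * \<rho> x \<theta>0"
            using norm_cut_gradient_squared_le[OF r] pos by (rule mult_right_mono)
          also have "\<dots> = 2 * ((norm (g x))\<^sup>2 * \<rho> x \<theta>0) + 2 * (4 * exp 1)\<^sup>2 * ((u x)\<^sup>2 * \<rho> x \<theta>0)"
            by (simp add: algebra_simps)
          finally show "norm ((norm (cut_gradient r u g x))\<^sup>2 * \<rho> x \<theta>0)
              \<le> norm (2 * ((norm (g x))\<^sup>2 * \<rho> x \<theta>0) + 2 * (4 * exp 1)\<^sup>2 * ((u x)\<^sup>2 * \<rho> x \<theta>0))"
            using pos[of x \<theta>0] by (simp add: abs_mult)
        qed
      qed simp
    qed (auto simp: K)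
  qed
qed

lemma H1_test_function:
  fixes h :: "'a::euclidean_space \<Rightarrow> real" and \<rho> :: "'a \<Rightarrow> real^'m \<Rightarrow> real"
  assumes family: "regular_family h \<rho>" and tf: "test_function \<psi>"
  shows "H1 (\<lambda>x. \<rho> x \<theta>) \<psi> (grad \<psi>)"
proof -
  obtain B where "0 < B" and B: "\<And>x. \<bar>\<psi> x\<bar> \<le> B" "\<And>x. norm (grad \<psi> x) \<le> B"
    using test_function_bounded[OF tf] by blast
  note [measurable] = borel_measurable_continuous_onI[OF test_function_continuous[OF tf]]
    borel_measurable_continuous_onI[OF test_function_continuous_grad[OF tf]]
  have le: "B\<^sup>2 \<le> B\<^sup>2 * (1 + \<bar>h x\<bar>)" for x by (simp add: distrib_left)
  have 1: "\<bar>(\<psi> x)\<^sup>2\<bar> \<le> B\<^sup>2" for x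
    using power_mono[OF B(1)[of x] abs_ge_zero, of 2] by simp
  have 2: "\<bar>(norm (grad \<psi> x))\<^sup>2\<bar> \<le> B\<^sup>2" for x
    using power_mono[OF B(2)[of x] norm_ge_zero, of 2] by simp
  show ?thesis
    unfolding H1_def
    using weak_gradient_test_function[OF tf]
      family_integrable_mult[OF family, of "\<lambda>x. (\<psi> x)\<^sup>2" "B\<^sup>2" \<theta>]
      family_integrable_mult[OF family, of "\<lambda>x. (norm (grad \<psi> x))\<^sup>2" "B\<^sup>2" \<theta>]
      order_trans[OF 1 le] order_trans[OF 2 le] by simp
qed

text \<open>For a cutoff of the solution at time \<open>s\<close>, the dual functional of \<open>dual_energy_le\<close> is continuous in \<open>t\<close>,
  since the competitor has compact support and only the density and the mean of \<open>h\<close> depend on \<open>t\<close>. All these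
  functionals are at most the energy at time \<open>t\<close>, hence they are bounded simultaneously on some
  subinterval. There the cutoffs of the solution at time \<open>t\<close> transfer the bound to the energy at time \<open>t\<close>.\<close>

lemma energy_bounded_on_subinterval:
  fixes h :: "'a::euclidean_space \<Rightarrow> real" and \<rho> :: "'a \<Rightarrow> real^'m \<Rightarrow> real"
    and \<theta> :: "real \<Rightarrow> real^'m"
  assumes family: "regular_family h \<rho>" and h: "continuous_on UNIV h"
    and ab: "a < b" and \<theta>: "continuous_on {a..b} \<theta>"
    and poisson: "\<And>t. t \<in> {a..b} \<Longrightarrow> weak_poisson_solution h (\<lambda>x. \<rho> x (\<theta> t)) (\<phi> t) (g t)"
  obtains c d N where "a \<le> c" "c < d" "d \<le> b"
    "\<And>t. t \<in> {c..d} \<Longrightarrow> (\<integral>x. (norm (g t x))\<^sup>2 * \<rho> x (\<theta> t) \<partial>lborel) \<le> N"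
proof -
  define m where "m t = mean h (\<lambda>x. \<rho> x (\<theta> t))" for t
  define G where "G s r = cut_gradient r (\<phi> s) (g s)" for s r
  define J where "J = (\<lambda>(s, r) t. 2 * (\<integral>x. (h x - m t) * (cutoff r x * \<phi> s x) * \<rho> x (\<theta> t) \<partial>lborel)
    - (\<integral>x. (norm (G s r x))\<^sup>2 * \<rho> x (\<theta> t) \<partial>lborel))"
  define F where "F t = (\<integral>x. (norm (g t x))\<^sup>2 * \<rho> x (\<theta> t) \<partial>lborel)" for t
  let ?I = "{a..b} \<times> {1::real..}"
  have [measurable]: "h \<in> borel_measurable borel"
    using h by (rule borel_measurable_continuous_onI)
  have \<rho>: "(\<lambda>x. \<rho> x (\<theta> t)) \<in> borel_measurable borel" "0 \<le> \<rho> x (\<theta> t)" for x t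
    using family_measurable[OF family] family_pos[OF family, of x "\<theta> t"] by auto
  have H: "H1 (\<lambda>x. \<rho> x (\<theta> s)) (\<phi> s) (g s)" if "s \<in> {a..b}" for s
    using poisson[OF that] by (simp add: weak_poisson_solution_def)
  have HG: "H1 (\<lambda>x. \<rho> x \<eta>) (\<lambda>x. cutoff r x * \<phi> s x) (G s r)" if "s \<in> {a..b}" "1 \<le> r" for s r \<eta>
    unfolding G_def by (rule H1_cutoff[OF family H[OF that(1)] that(2)])
  have J_le: "J (s, r) t \<le> F t" if "s \<in> {a..b}" "1 \<le> r" "t \<in> {a..b}" for s r t
    using dual_energy_le[OF poisson[OF that(3)] HG[OF that(1,2)] \<rho>]
    by (simp add: J_def F_def m_def)
  have J_cont: "continuous_on {a..b} (J (s, r))" if s: "s \<in> {a..b}" "1 \<le> r" for s r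
  proof -
    have "0 < r" using s by simp
    note tf = test_function_cutoff[OF this, where 'a='a]
    obtain K where K: "compact K" "\<And>x::'a. x \<notin> K \<Longrightarrow> cutoff r x = 0" "\<And>x::'a. x \<notin> K \<Longrightarrow> grad (cutoff r) x = 0"
      using test_function_support[OF tf] by blast
    have \<phi>: "set_integrable lborel K (\<phi> s)" if "compact K" for K
      using H[OF s(1)] that by (auto simp: H1_def weak_gradient_def)
    have i1: "integrable lborel (\<lambda>x. cutoff r x * \<phi> s x)"
      using locally_integrable_mult[OF \<phi> test_function_continuous[OF tf] K(1,2)] by simp
    have "continuous_on UNIV (\<lambda>x. h x * cutoff r x)"
      using h test_function_continuous[OF tf] by (intro continuous_intros)
    from locally_integrable_mult[OF \<phi> this K(1)] K(2)
    have i2: "integrable lborel (\<lambda>x. h x * (cutoff r x * \<phi> s x))" by (simp add: mult_ac)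
    have G0: "G s r x = 0" if "x \<notin> K" for x using K that by (simp add: G_def)
    note HGs = HG[OF s, of "\<theta> s"]
    have i3: "integrable lborel (\<lambda>x. (norm (G s r x))\<^sup>2)"
      using HGs H1_measurable[OF HGs] G0
        compact_support_integrable_iff[OF family _ K(1), of "\<lambda>x. (norm (G s r x))\<^sup>2" "\<theta> s"]
      by (simp add: H1_def)
    have c: "continuous_on {a..b} (\<lambda>t. \<integral>x. q x * \<rho> x (\<theta> t) \<partial>lborel)"
      if "integrable lborel q" "\<And>x. x \<notin> K \<Longrightarrow> q x = 0" for q
      using continuous_on_compose2[OF compact_support_expectation_continuous[OF family that(1) K(1) that(2)] \<theta>]
      by simp
    have "continuous_on {a..b} m"
      unfolding m_def mean_def
      using continuous_on_compose2[OF expectation_continuous[OF family, of h 1] \<theta>] by simp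
    then have "continuous_on {a..b} (\<lambda>t. 2 * ((\<integral>x. h x * (cutoff r x * \<phi> s x) * \<rho> x (\<theta> t) \<partial>lborel)
        - m t * (\<integral>x. cutoff r x * \<phi> s x * \<rho> x (\<theta> t) \<partial>lborel)) - (\<integral>x. (norm (G s r x))\<^sup>2 * \<rho> x (\<theta> t) \<partial>lborel))"
      using K G0 by (intro continuous_intros c i1 i2 i3) auto
    moreover have "(\<integral>x. (h x - m t) * (cutoff r x * \<phi> s x) * \<rho> x (\<theta> t) \<partial>lborel) =
      (\<integral>x. h x * (cutoff r x * \<phi> s x) * \<rho> x (\<theta> t) \<partial>lborel)
        - m t * (\<integral>x. cutoff r x * \<phi> s x * \<rho> x (\<theta> t) \<partial>lborel)" for t
    proof -
      have "integrable lborel (\<lambda>x. h x * (cutoff r x * \<phi> s x) * \<rho> x (\<theta> t))"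
        using compact_support_integrable_iff[OF family _ K(1), of "\<lambda>x. h x * (cutoff r x * \<phi> s x)"]
          i2 borel_measurable_integrable[OF i2] K(2) by simp
      moreover have "integrable lborel (\<lambda>x. cutoff r x * \<phi> s x * \<rho> x (\<theta> t))"
        using compact_support_integrable_iff[OF family _ K(1), of "\<lambda>x. cutoff r x * \<phi> s x"]
          i1 borel_measurable_integrable[OF i1] K(2) by simp
      moreover have "(\<lambda>x. (h x - m t) * (cutoff r x * \<phi> s x) * \<rho> x (\<theta> t)) =
        (\<lambda>x. h x * (cutoff r x * \<phi> s x) * \<rho> x (\<theta> t) - m t * (cutoff r x * \<phi> s x * \<rho> x (\<theta> t)))"
        by (simp add: algebra_simps)
      ultimately show ?thesis by simp
    qed
    ultimately show ?thesis by (simp add: J_def)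
  qed
  obtain c d N where cd: "a \<le> c" "c < d" "d \<le> b"
    and N: "\<And>i t. i \<in> ?I \<Longrightarrow> t \<in> {c..d} \<Longrightarrow> J i t \<le> N"
  proof (rule pointwise_bounded_continuous_family[OF ab, of ?I J F])
    show "continuous_on {a..b} (J i)" if "i \<in> ?I" for i
      using that J_cont by (cases i) auto
    show "J i t \<le> F t" if "i \<in> ?I" "t \<in> {a..b}" for i t
      using that J_le by (cases i) auto
  qed blast
  have "F t \<le> N" if t: "t \<in> {c..d}" for t
  proof (rule tendsto_upperbound)
    have t': "t \<in> {a..b}" using t cd by auto
    show "((\<lambda>r. \<integral>x. (2 * (g t x \<bullet> cut_gradient r (\<phi> t) (g t) x)
        - (norm (cut_gradient r (\<phi> t) (g t) x))\<^sup>2) * \<rho> x (\<theta> t) \<partial>lborel) \<longlongrightarrow> F t) at_top"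
      unfolding F_def by (rule cutoff_energy_tendsto[OF H[OF t'] \<rho>])
    show "\<forall>\<^sub>F r in at_top. (\<integral>x. (2 * (g t x \<bullet> cut_gradient r (\<phi> t) (g t) x)
        - (norm (cut_gradient r (\<phi> t) (g t) x))\<^sup>2) * \<rho> x (\<theta> t) \<partial>lborel) \<le> N"
      using eventually_ge_at_top[of 1]
    proof eventually_elim
      case (elim r)
      note HGt = HG[OF t' elim, of "\<theta> t"]
      have i: "integrable lborel (\<lambda>x. (g t x \<bullet> G t r x) * \<rho> x (\<theta> t))"
          "integrable lborel (\<lambda>x. (norm (G t r x))\<^sup>2 * \<rho> x (\<theta> t))"
        using integrable_inner_gradients[OF H[OF t'] HGt \<rho>] HGt by (auto simp: H1_def)
      have "(\<integral>x. (2 * (g t x \<bullet> G t r x) - (norm (G t r x))\<^sup>2) * \<rho> x (\<theta> t) \<partial>lborel) =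
         (\<integral>x. 2 * ((g t x \<bullet> G t r x) * \<rho> x (\<theta> t)) - (norm (G t r x))\<^sup>2 * \<rho> x (\<theta> t) \<partial>lborel)"
        by (simp add: algebra_simps)
      also have "\<dots> = J (t, r) t"
        using i poisson[OF t'] HGt by (auto simp: J_def m_def weak_poisson_solution_def)
      also have "\<dots> \<le> N" using N[of "(t, r)" t] t t' elim by simp
      finally show ?case by (simp add: G_def)
    qed
  qed simp
  then show ?thesis
    unfolding F_def by (rule that[OF cd])
qed

section \<open>The weak continuity equation and the natural gradient flow\<close>

lemma matrix_vector_mult_eq_imp:
  fixes A :: "real^'m^'m"
  assumes "invertible A" "A *v x = y"
  shows "x = matrix_inv A *v y"
proof -
  have "matrix_inv A ** A = mat 1"
    using assms(1) unfolding invertible_def matrix_inv_def by (metis (mono_tags, lifting) someI_ex)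
  then show ?thesis
    using assms(2) by (metis matrix_vector_mul_assoc matrix_vector_mul_lid)
qed

lemma has_integral_0_imp_zero:
  fixes f :: "real \<Rightarrow> real"
  assumes ab: "a < b" and cont: "continuous_on {a..b} f" and int: "(f has_integral 0) {a..b}"
  obtains t where "a < t" "t < b" "f t = 0"
proof -
  let ?F = "\<lambda>x. integral {a..x} f"
  have d: "(?F has_real_derivative f t) (at t within {a..b})" if "t \<in> {a..b}" for t
    using cont that by (rule integral_has_real_derivative)
  have "\<exists>t. a < t \<and> t < b \<and> (\<lambda>v. v * f t) = (\<lambda>v. 0)"
  proof (rule Rolle_deriv[OF ab])
    show "?F a = ?F b" using int by (simp add: integral_unique)
    show "continuous_on {a..b} ?F" using d by (rule DERIV_continuous_on)
    show "(?F has_derivative (\<lambda>v. v * f t)) (at t)" if "a < t" "t < b" for t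
    proof -
      have "at t within {a..b} = at t"
        using that by (intro at_within_interior) (simp add: interior_atLeastAtMost_real)
      moreover have "(*) (f t) = (\<lambda>v. v * f t)" by (simp add: fun_eq_iff mult.commute)
      ultimately show ?thesis
        using d[of t] that by (simp add: has_field_derivative_def)
    qed
  qed
  then show ?thesis using that by (metis mult_1)
qed

text \<open>The difference \<open>f - g\<close>, if nonzero at \<open>t\<close>, would stay nonzero on an interval to the right of \<open>t\<close>.\<close>

lemma eq_if_dense_eq:
  fixes f g :: "real \<Rightarrow> real"
  assumes "continuous_on {0..} f" "continuous_on {0..} g"
    and dense: "\<And>a b. 0 \<le> a \<Longrightarrow> a < b \<Longrightarrow> \<exists>t. a < t \<and> t < b \<and> f t = g t"
    and t: "0 \<le> t"
  shows "f t = g t"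
proof (rule ccontr)
  assume "f t \<noteq> g t"
  have "continuous_on {0..} (\<lambda>t. f t - g t)" using assms by (intro continuous_intros)
  then have "((\<lambda>t. f t - g t) \<longlongrightarrow> f t - g t) (at t within {0..})"
    using t by (simp add: continuous_on_def)
  then have "\<forall>\<^sub>F s in at t within {0..}. f s - g s \<noteq> 0"
    using \<open>f t \<noteq> g t\<close> by (intro tendsto_imp_eventually_ne) auto
  then obtain \<delta> where "0 < \<delta>" "\<And>s. 0 \<le> s \<Longrightarrow> s \<noteq> t \<Longrightarrow> dist s t < \<delta> \<Longrightarrow> f s - g s \<noteq> 0"
    unfolding eventually_at by auto
  moreover obtain s where "t < s" "s < t + \<delta>" "f s = g s"
    using dense[of t "t + \<delta>"] t \<open>0 < \<delta>\<close> by auto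
  ultimately show False using t by (auto simp: dist_real_def)
qed

text \<open>The left-hand side is the time derivative of \<open>\<integral> \<psi> * p\<close>, that is, of the expectation of \<open>\<psi> (X t)\<close>, computed
  from the parametrisation; the right-hand side is the expectation of the time derivative of \<open>\<psi> (X t)\<close>,
  rewritten by the weak Poisson equation. Both are continuous in \<open>t\<close>. In every interval there is a
  subinterval on which the energy is bounded; there the expectation may be differentiated under the
  integral, so the two sides have the same integral over the subinterval and agree at some time in it. Thus
  they agree on a dense set of times, hence always.\<close>

lemma weak_continuity_equation:
  fixes M :: "'w measure" and X :: "real \<Rightarrow> 'w \<Rightarrow> 'a::euclidean_space"
    and h :: "'a \<Rightarrow> real" and \<rho> :: "'a \<Rightarrow> real^'m \<Rightarrow> real" and \<theta> \<theta>' :: "real \<Rightarrow> real^'m"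
  assumes M: "prob_space M" and h: "continuous_on UNIV h" and \<beta>: "0 < \<beta>"
    and dynamics: "AE \<omega> in M. \<forall>t\<ge>0.
      ((\<lambda>s. X s \<omega>) has_vector_derivative - \<beta> *\<^sub>R g t (X t \<omega>)) (at t within {0..})"
    and density: "\<And>t. 0 \<le> t \<Longrightarrow> distributed M lborel (X t) (\<lambda>x. ennreal (\<rho> x (\<theta> t)))"
    and poisson: "\<And>t. 0 \<le> t \<Longrightarrow> weak_poisson_solution h (\<lambda>x. \<rho> x (\<theta> t)) (\<phi> t) (g t)"
    and family: "regular_family h \<rho>"
    and \<theta>: "\<And>t. 0 \<le> t \<Longrightarrow> (\<theta> has_vector_derivative \<theta>' t) (at t within {0..})"
      "continuous_on {0..} \<theta>'"
    and \<psi>: "test_function \<psi>" and t: "0 \<le> t"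
  shows "\<theta>' t \<bullet> (\<integral>x. (\<psi> x * \<rho> x (\<theta> t)) *\<^sub>R score \<rho> x (\<theta> t) \<partial>lborel) =
    - \<beta> * (\<integral>x. (h x - mean h (\<lambda>x. \<rho> x (\<theta> t))) * \<psi> x * \<rho> x (\<theta> t) \<partial>lborel)"
proof -
  obtain B where B: "0 < B" "\<And>x. \<bar>\<psi> x\<bar> \<le> B" "\<And>x. norm (grad \<psi> x) \<le> B"
    using test_function_bounded[OF \<psi>] by blast
  have hm [measurable]: "h \<in> borel_measurable borel"
    using h by (rule borel_measurable_continuous_onI)
  have \<psi>m [measurable]: "\<psi> \<in> borel_measurable borel" "grad \<psi> \<in> borel_measurable borel"
    using test_function_continuous[OF \<psi>] test_function_continuous_grad[OF \<psi>]
    by (auto intro: borel_measurable_continuous_onI)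
  have \<psi>_le: "\<bar>\<psi> x\<bar> \<le> B * (1 + \<bar>h x\<bar>)" for x
    using B(2)[of x] mult_nonneg_nonneg[OF less_imp_le[OF B(1)] abs_ge_zero, of "h x"]
    unfolding distrib_left by linarith
  have h\<psi>_le: "\<bar>h x * \<psi> x\<bar> \<le> B * (1 + \<bar>h x\<bar>)" for x
  proof -
    have "\<bar>h x * \<psi> x\<bar> \<le> \<bar>h x\<bar> * B" using B(2) by (simp add: abs_mult mult_left_mono)
    then show ?thesis using B(1) by (simp add: algebra_simps)
  qed
  have h\<psi>m: "(\<lambda>x. h x * \<psi> x) \<in> borel_measurable borel" by measurable
  have \<rho>: "(\<lambda>x. \<rho> x (\<theta> t)) \<in> borel_measurable borel" "0 \<le> \<rho> x (\<theta> t)" for x t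
    using family_measurable[OF family] family_pos[OF family, of x "\<theta> t"] by auto
  have \<theta>_cont: "continuous_on {0..} \<theta>"
    using \<theta>(1) by (intro continuous_on_vector_derivative) auto
  define m where "m t = mean h (\<lambda>x. \<rho> x (\<theta> t))" for t
  define u where "u t = (\<integral>x. \<psi> x * \<rho> x (\<theta> t) \<partial>lborel)" for t
  define u' where "u' t = \<theta>' t \<bullet> (\<integral>x. (\<psi> x * \<rho> x (\<theta> t)) *\<^sub>R score \<rho> x (\<theta> t) \<partial>lborel)" for t
  define v where "v t = - \<beta> * (\<integral>x. (h x - m t) * \<psi> x * \<rho> x (\<theta> t) \<partial>lborel)" for t
  have u_deriv: "(u has_real_derivative u' t) (at t within {0..})" if "0 \<le> t" for t
  proof -
    have "((\<lambda>\<eta>. \<integral>x. \<psi> x * \<rho> x \<eta> \<partial>lborel) has_derivative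
        (\<lambda>w. w \<bullet> (\<integral>x. (\<psi> x * \<rho> x (\<theta> t)) *\<^sub>R score \<rho> x (\<theta> t) \<partial>lborel))) (at (\<theta> t))"
      using expectation_GDERIV[OF family \<psi>m(1) \<psi>_le] by (simp add: gderiv_def)
    from has_derivative_compose[OF \<theta>(1)[OF that, unfolded has_vector_derivative_def] this]
    show ?thesis
      by (simp add: u_def[abs_def] u'_def has_field_derivative_def mult.commute[of _ "\<theta>' t \<bullet> _"])
  qed
  have u'_cont: "continuous_on {0..} u'"
    unfolding u'_def
    using continuous_on_compose2[OF expectation_gradient_continuous[OF family \<psi>m(1) \<psi>_le] \<theta>_cont] \<theta>(2)
    by (intro continuous_intros) auto
  have v_eq: "v t = - \<beta> * ((\<integral>x. h x * \<psi> x * \<rho> x (\<theta> t) \<partial>lborel) - m t * u t)" for t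
  proof -
    have "integrable lborel (\<lambda>x. h x * \<psi> x * \<rho> x (\<theta> t))" "integrable lborel (\<lambda>x. \<psi> x * \<rho> x (\<theta> t))"
      using family_integrable_mult[OF family h\<psi>m h\<psi>_le] family_integrable_mult[OF family \<psi>m(1) \<psi>_le] by auto
    moreover have "(\<lambda>x. (h x - m t) * \<psi> x * \<rho> x (\<theta> t)) =
        (\<lambda>x. h x * \<psi> x * \<rho> x (\<theta> t) - m t * (\<psi> x * \<rho> x (\<theta> t)))"
      by (simp add: algebra_simps)
    ultimately show ?thesis by (simp add: v_def u_def)
  qed
  have m_cont: "continuous_on {0..} m"
    unfolding m_def mean_def
    using continuous_on_compose2[OF expectation_continuous[OF family hm, of 1] \<theta>_cont] by simp
  have u_cont: "continuous_on {0..} u"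
    unfolding u_def
    using continuous_on_compose2[OF expectation_continuous[OF family \<psi>m(1) \<psi>_le] \<theta>_cont] by simp
  have v_cont: "continuous_on {0..} v"
    unfolding v_eq
    using continuous_on_compose2[OF expectation_continuous[OF family h\<psi>m h\<psi>_le] \<theta>_cont] m_cont u_cont
    by (intro continuous_intros) auto
  have dense: "\<exists>t. a < t \<and> t < b \<and> u' t = v t" if ab: "0 \<le> a" "a < b" for a b
  proof -
    obtain c d N where cd: "a \<le> c" "c < d" "d \<le> b"
      and N: "\<And>t. t \<in> {c..d} \<Longrightarrow> (\<integral>x. (norm (g t x))\<^sup>2 * \<rho> x (\<theta> t) \<partial>lborel) \<le> N"
    proof (rule energy_bounded_on_subinterval[OF family h ab(2)])
      show "continuous_on {a..b} \<theta>"
        using \<theta>_cont ab by (auto intro: continuous_on_subset)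
      show "weak_poisson_solution h (\<lambda>x. \<rho> x (\<theta> t)) (\<phi> t) (g t)" if "t \<in> {a..b}" for t
        using poisson that ab by auto
    qed blast
    have nonneg: "0 \<le> t" if "t \<in> {c..d}" for t using that cd ab by auto
    define \<eta> where "\<eta> t \<omega> = - \<beta> * (g t (X t \<omega>) \<bullet> grad \<psi> (X t \<omega>))" for t \<omega>
    have \<eta>: "integrable M (\<eta> t)" "(\<integral>\<omega>. \<bar>\<eta> t \<omega>\<bar> \<partial>M) \<le> \<beta> * (B * (1 + N))" "(\<integral>\<omega>. \<eta> t \<omega> \<partial>M) = v t"
      if t: "t \<in> {c..d}" for t
    proof -
      note t0 = nonneg[OF t]
      have H: "H1 (\<lambda>x. \<rho> x (\<theta> t)) (\<phi> t) (g t)"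
        using poisson[OF t0] by (simp add: weak_poisson_solution_def)
      note H\<psi> = H1_test_function[OF family \<psi>, of "\<theta> t"]
      note [measurable] = H1_measurable[OF H]
      let ?f = "\<lambda>x. - \<beta> * (g t x \<bullet> grad \<psi> x)"
      have fm: "?f \<in> borel_measurable lborel" by measurable
      have i: "integrable lborel (\<lambda>x. (g t x \<bullet> grad \<psi> x) * \<rho> x (\<theta> t))"
        by (rule integrable_inner_gradients[OF H H\<psi> \<rho>])
      then have "integrable lborel (\<lambda>x. \<rho> x (\<theta> t) * ?f x)"
        using integrable_mult_right[OF i, of "- \<beta>"] by (simp add: mult_ac)
      then show "integrable M (\<eta> t)"
        using distributed_integrable[OF density[OF t0] fm] \<rho> by (simp add: \<eta>_def[abs_def])
      have "(\<integral>\<omega>. \<eta> t \<omega> \<partial>M) = (\<integral>x. \<rho> x (\<theta> t) * ?f x \<partial>lborel)"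
        using distributed_integral[OF density[OF t0] fm] \<rho> by (simp add: \<eta>_def)
      also have "\<dots> = - \<beta> * (\<integral>x. (g t x \<bullet> grad \<psi> x) * \<rho> x (\<theta> t) \<partial>lborel)"
        by (subst integral_mult_right_zero[symmetric]) (simp add: mult_ac)
      also have "\<dots> = v t"
        using poisson[OF t0] H\<psi> by (simp add: v_def m_def weak_poisson_solution_def)
      finally show "(\<integral>\<omega>. \<eta> t \<omega> \<partial>M) = v t" .
      have "(\<integral>\<omega>. \<bar>\<eta> t \<omega>\<bar> \<partial>M) = (\<integral>x. \<rho> x (\<theta> t) * \<bar>?f x\<bar> \<partial>lborel)"
        using distributed_integral[OF density[OF t0] borel_measurable_abs[OF fm]] \<rho> by (simp add: \<eta>_def)
      also have "\<dots> \<le> (\<integral>x. \<beta> * (B * (\<rho> x (\<theta> t) + (norm (g t x))\<^sup>2 * \<rho> x (\<theta> t))) \<partial>lborel)"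
      proof (rule integral_mono)
        show "integrable lborel (\<lambda>x. \<rho> x (\<theta> t) * \<bar>?f x\<bar>)"
          using integrable_mult_right[OF integrable_abs[OF i], of \<beta>] \<rho>(2) \<beta> by (simp add: abs_mult mult_ac)
        show "integrable lborel (\<lambda>x. \<beta> * (B * (\<rho> x (\<theta> t) + (norm (g t x))\<^sup>2 * \<rho> x (\<theta> t))))"
          using H family_integrable(1)[OF family] by (simp add: H1_def)
        fix x
        have "norm (g t x) \<le> 1 + (norm (g t x))\<^sup>2"
          using zero_le_power2[of "norm (g t x) - 1"] norm_ge_zero[of "g t x"]
          unfolding power2_diff power_one mult_1_right by linarith
        then have "norm (g t x) * norm (grad \<psi> x) \<le> (1 + (norm (g t x))\<^sup>2) * B"
          using B by (intro mult_mono) auto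
        then have "\<bar>g t x \<bullet> grad \<psi> x\<bar> \<le> (1 + (norm (g t x))\<^sup>2) * B"
          using Cauchy_Schwarz_ineq2[of "g t x" "grad \<psi> x"] by linarith
        then have "\<beta> * \<rho> x (\<theta> t) * \<bar>g t x \<bullet> grad \<psi> x\<bar> \<le> \<beta> * \<rho> x (\<theta> t) * ((1 + (norm (g t x))\<^sup>2) * B)"
          using \<beta> \<rho>(2) by (intro mult_left_mono) auto
        then show "\<rho> x (\<theta> t) * \<bar>?f x\<bar> \<le> \<beta> * (B * (\<rho> x (\<theta> t) + (norm (g t x))\<^sup>2 * \<rho> x (\<theta> t)))"
          using \<beta> by (simp add: abs_mult algebra_simps)
      qed
      also have "\<dots> = \<beta> * (B * (1 + (\<integral>x. (norm (g t x))\<^sup>2 * \<rho> x (\<theta> t) \<partial>lborel)))"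
        using H family_integrable[OF family] by (simp add: H1_def)
      also have "\<dots> \<le> \<beta> * (B * (1 + N))"
        using N[OF t] \<beta> B(1) by (intro mult_left_mono add_left_mono) auto
      finally show "(\<integral>\<omega>. \<bar>\<eta> t \<omega>\<bar> \<partial>M) \<le> \<beta> * (B * (1 + N))" .
    qed
    have \<xi>: "integrable M (\<lambda>\<omega>. \<psi> (X t \<omega>))" "(\<integral>\<omega>. \<psi> (X t \<omega>) \<partial>M) = u t"
      if t: "t \<in> {c..d}" for t
    proof -
      note t0 = nonneg[OF t]
      have "integrable lborel (\<lambda>x. \<rho> x (\<theta> t) * \<psi> x)"
        using family_integrable_mult[OF family \<psi>m(1) \<psi>_le, of "\<theta> t"] by (simp add: mult.commute)
      then show "integrable M (\<lambda>\<omega>. \<psi> (X t \<omega>))"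
        using distributed_integrable[OF density[OF t0], of \<psi>] \<rho> by simp
      show "(\<integral>\<omega>. \<psi> (X t \<omega>) \<partial>M) = u t"
        using distributed_integral[OF density[OF t0], of \<psi>] \<rho> by (simp add: u_def mult.commute)
    qed
    have "((\<lambda>t. \<integral>\<omega>. \<eta> t \<omega> \<partial>M) has_integral ((\<integral>\<omega>. \<psi> (X d \<omega>) \<partial>M) - (\<integral>\<omega>. \<psi> (X c \<omega>) \<partial>M))) {c..d}"
    proof (rule expectation_increment_has_integral[OF M cd(2), where \<xi>="\<lambda>t \<omega>. \<psi> (X t \<omega>)"])
      show "AE \<omega> in M. \<forall>t\<in>{c..d}. ((\<lambda>s. \<psi> (X s \<omega>)) has_real_derivative \<eta> t \<omega>) (at t within {c..d})"
        using dynamics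
      proof eventually_elim
        case (elim \<omega>)
        show ?case
        proof
          fix t assume t: "t \<in> {c..d}"
          have "((\<lambda>s. X s \<omega>) has_vector_derivative - \<beta> *\<^sub>R g t (X t \<omega>)) (at t within {c..d})"
            using elim nonneg[OF t] nonneg by (meson atLeast_iff has_vector_derivative_within_subset subsetI)
          moreover have "(\<psi> has_derivative (\<lambda>w. w \<bullet> grad \<psi> (X t \<omega>))) (at (X t \<omega>))"
            using GDERIV_grad[OF test_function_differentiable[OF \<psi>]] by (simp add: gderiv_def)
          ultimately have "((\<lambda>s. \<psi> (X s \<omega>)) has_derivative (\<lambda>s. (s *\<^sub>R (- \<beta> *\<^sub>R g t (X t \<omega>))) \<bullet> grad \<psi> (X t \<omega>)))
              (at t within {c..d})"
            unfolding has_vector_derivative_def by (rule has_derivative_compose)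
          then show "((\<lambda>s. \<psi> (X s \<omega>)) has_real_derivative \<eta> t \<omega>) (at t within {c..d})"
            unfolding has_field_derivative_def \<eta>_def by (rule has_derivative_eq_rhs) (auto simp: mult_ac)
        qed
      qed
    qed (use \<xi>(1) \<eta>(1,2) cd in \<open>auto simp: borel_measurable_integrable\<close>)
    then have "((\<lambda>t. \<integral>\<omega>. \<eta> t \<omega> \<partial>M) has_integral (u d - u c)) {c..d}"
      using \<xi>(2) cd by simp
    then have v: "(v has_integral (u d - u c)) {c..d}"
      by (rule has_integral_eq[rotated]) (simp add: \<eta>(3))
    have "(u' has_integral (u d - u c)) {c..d}"
    proof (rule fundamental_theorem_of_calculus)
      show "(u has_vector_derivative u' t) (at t within {c..d})" if "t \<in> {c..d}" for t
        using DERIV_subset[OF u_deriv[OF nonneg[OF that]], of "{c..d}"] nonneg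
        by (auto simp: has_real_derivative_iff_has_vector_derivative)
    qed (use cd in simp)
    from has_integral_diff[OF this v] have "((\<lambda>t. u' t - v t) has_integral 0) {c..d}" by simp
    moreover have "continuous_on {c..d} (\<lambda>t. u' t - v t)"
      using u'_cont v_cont nonneg by (intro continuous_intros) (auto intro: continuous_on_subset)
    ultimately obtain t where "c < t" "t < d" "u' t - v t = 0"
      using has_integral_0_imp_zero[OF cd(2)] by blast
    then show ?thesis using cd by (intro exI[of _ t]) auto
  qed
  have "u' t = v t"
    using eq_if_dense_eq[OF u'_cont v_cont dense t] .
  then show ?thesis by (simp add: u'_def v_def m_def)
qed

text \<open>The difference of the two sides of the weak identity is the integral of \<open>\<psi>\<close> against a fixed integrable
  function, namely \<open>\<rho>\<close> times the expression in the conclusion, and \<open>\<rho>\<close> is positive.\<close>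

lemma score_velocity_eq_centred_cost:
  fixes h :: "'a::euclidean_space \<Rightarrow> real" and \<rho> :: "'a \<Rightarrow> real^'m \<Rightarrow> real"
  assumes family: "regular_family h \<rho>" and hm [measurable]: "h \<in> borel_measurable borel"
    and weak: "\<And>\<psi>. test_function \<psi> \<Longrightarrow> v \<bullet> (\<integral>x. (\<psi> x * \<rho> x \<theta>) *\<^sub>R score \<rho> x \<theta> \<partial>lborel) =
      - \<beta> * (\<integral>x. (h x - c) * \<psi> x * \<rho> x \<theta> \<partial>lborel)"
  shows "AE x in lborel. score \<rho> x \<theta> \<bullet> v + \<beta> * (h x - c) = 0"
proof -
  let ?q = "\<lambda>x. (score \<rho> x \<theta> \<bullet> v + \<beta> * (h x - c)) * \<rho> x \<theta>"
  have i1: "integrable lborel (\<lambda>x. \<rho> x \<theta> *\<^sub>R score \<rho> x \<theta>)"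
    using family_integrable_score[OF family, of "\<lambda>_. 1" 1 \<theta>] by simp
  have i2: "integrable lborel (\<lambda>x. h x * \<rho> x \<theta>)" "integrable lborel (\<lambda>x. \<rho> x \<theta>)"
    using family_cost_integrable[OF family] family_integrable(1)[OF family] by auto
  have q_eq: "?q = (\<lambda>x. (\<rho> x \<theta> *\<^sub>R score \<rho> x \<theta>) \<bullet> v + \<beta> * (h x * \<rho> x \<theta> - c * \<rho> x \<theta>))"
    by (simp add: algebra_simps)
  have "AE x in lborel. ?q x = 0"
  proof (rule fundamental_lemma)
    show "integrable lborel ?q"
      unfolding q_eq
      by (intro Bochner_Integration.integrable_add integrable_inner_left integrable_mult_right
          Bochner_Integration.integrable_diff i1 i2)
    fix \<psi> :: "'a \<Rightarrow> real" assume \<psi>: "test_function \<psi>"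
    obtain B where B: "0 < B" "\<And>x. \<bar>\<psi> x\<bar> \<le> B" "\<And>x. norm (grad \<psi> x) \<le> B"
      using test_function_bounded[OF \<psi>] by blast
    have \<psi>m [measurable]: "\<psi> \<in> borel_measurable borel"
      using test_function_continuous[OF \<psi>] by (rule borel_measurable_continuous_onI)
    have \<psi>_le: "\<bar>\<psi> x\<bar> \<le> B * (1 + \<bar>h x\<bar>)" for x
      using B(2)[of x] mult_nonneg_nonneg[OF less_imp_le[OF B(1)] abs_ge_zero, of "h x"]
      unfolding distrib_left by linarith
    have h\<psi>_le: "\<bar>(h x - c) * \<psi> x\<bar> \<le> ((1 + \<bar>c\<bar>) * B) * (1 + \<bar>h x\<bar>)" for x
    proof -
      have "\<bar>h x - c\<bar> \<le> (1 + \<bar>c\<bar>) * (1 + \<bar>h x\<bar>)"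
        using mult_nonneg_nonneg[OF abs_ge_zero[of c] abs_ge_zero[of "h x"]]
        unfolding distrib_left distrib_right by linarith
      then have "\<bar>h x - c\<bar> * \<bar>\<psi> x\<bar> \<le> ((1 + \<bar>c\<bar>) * (1 + \<bar>h x\<bar>)) * B"
        using B(2) by (intro mult_mono) auto
      then show ?thesis by (simp add: abs_mult mult_ac)
    qed
    have j1: "integrable lborel (\<lambda>x. (\<psi> x * \<rho> x \<theta>) *\<^sub>R score \<rho> x \<theta>)"
      by (rule family_integrable_score[OF family \<psi>m \<psi>_le])
    have j2: "integrable lborel (\<lambda>x. (h x - c) * \<psi> x * \<rho> x \<theta>)"
      by (rule family_integrable_mult[OF family _ h\<psi>_le]) simp
    have "(\<integral>x. \<psi> x * ?q x \<partial>lborel) =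
        (\<integral>x. v \<bullet> ((\<psi> x * \<rho> x \<theta>) *\<^sub>R score \<rho> x \<theta>) + \<beta> * ((h x - c) * \<psi> x * \<rho> x \<theta>) \<partial>lborel)"
      by (simp add: algebra_simps inner_commute)
    also have "\<dots> = v \<bullet> (\<integral>x. (\<psi> x * \<rho> x \<theta>) *\<^sub>R score \<rho> x \<theta> \<partial>lborel) +
        \<beta> * (\<integral>x. (h x - c) * \<psi> x * \<rho> x \<theta> \<partial>lborel)"
      using integral_inner_right[OF j1, of v] integrable_inner_right[OF j1, of v] j2 by simp
    also have "\<dots> = 0" using weak[OF \<psi>] by simp
    finally show "(\<integral>x. \<psi> x * ?q x \<partial>lborel) = 0" .
  qed
  then show ?thesis
    by eventually_elim (metis family_pos[OF family] less_irrefl mult_eq_0_iff)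
qed

theorem proposition2:
  fixes M :: "'w measure"
    and X :: "real \<Rightarrow> 'w \<Rightarrow> real^'d"
    and h p0 :: "real^'d \<Rightarrow> real"
    and p :: "real^'d \<Rightarrow> real \<Rightarrow> real"
    and \<phi> :: "real \<Rightarrow> real^'d \<Rightarrow> real"
    and grad\<phi> :: "real \<Rightarrow> real^'d \<Rightarrow> real^'d"
    and \<rho> :: "real^'d \<Rightarrow> real^'m \<Rightarrow> real"
    and \<theta> \<theta>' :: "real \<Rightarrow> real^'m"
    and \<beta> :: real
  assumes "prob_space M"
    and "assumption_A1 p0" and "assumption_A2 p0 h" and "assumption_A3 h"
    and "\<beta> > 0"
    and initial: "distributed M lborel (X 0) (\<lambda>x. ennreal (p0 x))"
    and dynamics: "AE \<omega> in M. \<forall>t\<ge>0.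
      ((\<lambda>s. X s \<omega>) has_vector_derivative - \<beta> *\<^sub>R grad\<phi> t (X t \<omega>)) (at t within {0..})"
    and density: "\<And>t. t \<ge> 0 \<Longrightarrow> distributed M lborel (X t) (\<lambda>x. ennreal (p x t))"
    and poisson: "\<And>t. t \<ge> 0 \<Longrightarrow> weak_poisson_solution h (\<lambda>x. p x t) (\<phi> t) (grad\<phi> t)"
    and param_form: "\<And>x t. t \<ge> 0 \<Longrightarrow> p x t = \<rho> x (\<theta> t)"
    and family: "regular_family h \<rho>"
    and \<theta>_C1: "\<And>t. t \<ge> 0 \<Longrightarrow> (\<theta> has_vector_derivative \<theta>' t) (at t within {0..})"
      "continuous_on {0..} \<theta>'"
    and fisher: "\<And>\<eta>. invertible (fisher_matrix \<rho> \<eta>)"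
  shows "(\<forall>\<eta>. GDERIV (expected_cost h \<rho>) \<eta> :> cost_gradient h \<rho> \<eta>) \<and>
    (\<forall>t\<ge>0. (\<theta> has_vector_derivative
       - \<beta> *\<^sub>R (matrix_inv (fisher_matrix \<rho> (\<theta> t)) *v cost_gradient h \<rho> (\<theta> t)))
       (at t within {0..}))"
proof (intro conjI allI impI)
  have h: "continuous_on UNIV h"
    using \<open>assumption_A2 p0 h\<close> unfolding assumption_A2_def by (blast intro: Ck_continuous)
  then have hm: "h \<in> borel_measurable borel"
    by (rule borel_measurable_continuous_onI)
  show "GDERIV (expected_cost h \<rho>) \<eta> :> cost_gradient h \<rho> \<eta>" for \<eta>
    by (rule expected_cost_GDERIV[OF family hm])
  fix t :: real assume t: "0 \<le> t"
  have density': "distributed M lborel (X s) (\<lambda>x. ennreal (\<rho> x (\<theta> s)))" if "0 \<le> s" for s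
    using density[OF that] by (simp add: param_form[OF that])
  have poisson': "weak_poisson_solution h (\<lambda>x. \<rho> x (\<theta> s)) (\<phi> s) (grad\<phi> s)" if "0 \<le> s" for s
    using poisson[OF that] by (simp add: param_form[OF that])
  have "AE x in lborel. score \<rho> x (\<theta> t) \<bullet> \<theta>' t + \<beta> * (h x - mean h (\<lambda>x. \<rho> x (\<theta> t))) = 0"
    using weak_continuity_equation[OF \<open>prob_space M\<close> h \<open>\<beta> > 0\<close> dynamics density' poisson' family \<theta>_C1 _ t]
    by (intro score_velocity_eq_centred_cost[OF family hm])
  then have "fisher_matrix \<rho> (\<theta> t) *v \<theta>' t = - \<beta> *\<^sub>R cost_gradient h \<rho> (\<theta> t)"
    by (rule natural_gradient_identity[OF family hm])
  then have "\<theta>' t = matrix_inv (fisher_matrix \<rho> (\<theta> t)) *v (- \<beta> *\<^sub>R cost_gradient h \<rho> (\<theta> t))"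
    by (rule matrix_vector_mult_eq_imp[OF fisher])
  then have "\<theta>' t = - \<beta> *\<^sub>R (matrix_inv (fisher_matrix \<rho> (\<theta> t)) *v cost_gradient h \<rho> (\<theta> t))"
    by (simp only: matrix_vector_mult_scaleR)
  with \<theta>_C1(1)[OF t]
  show "(\<theta> has_vector_derivative
       - \<beta> *\<^sub>R (matrix_inv (fisher_matrix \<rho> (\<theta> t)) *v cost_gradient h \<rho> (\<theta> t))) (at t within {0..})"
    by simp
qed

end
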